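(* For every real $\epsilon > 0$ there are infinitely many positive integers $n$ (large enough that the iterated logarithms below are defined and positive) such that $$K(n) > \left(\frac{3}{4\pi^2} - \epsilon\right)(\log n)\,\frac{(\log_{2} n)(\log_{4} n)}{(\log_{3} n)^2}.$$
   Context: For a positive integer $m$, $d(m)$ denotes the number of positive divisors of $m$. For a positive integer $n$, $$K(n) := \min\left\{K \ge 1 : \frac{d((n+K)!)}{d(n!)} \ge 2\right\},$$ the minimum being over positive integers $K$ (it exists, since $K(n)\le p-n$ where $p$ is the least prime exceeding $n$). Here $\log$ is the natural logarithm and $\log_j$ denotes the $j$-th iterated logarithm, $\log_1 x := \log x$, $\log_j x := \log(\log_{j-1} x)$ for $j \ge 2$, defined for sufficiently large $x$. *)

theory Defs
  imports "HOL-Analysis.Analysis" "HOL-Computational_Algebra.Primes"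
begin

text \<open>Only used at positive arguments; the junk value is \<open>num_divisors 0 = 0\<close>,
  the cardinality of an infinite set.\<close>

definition num_divisors :: "nat \<Rightarrow> nat" where
  "num_divisors m = card {k. k dvd m}"

text \<open>The minimum exists for every \<open>n\<close>, see \<open>K_fact_exists\<close> below.\<close>

definition K_fact :: "nat \<Rightarrow> nat" where
  "K_fact n = (LEAST K. K \<ge> 1 \<and>
     real (num_divisors (fact (n + K))) / real (num_divisors (fact n)) \<ge> 2)"

text \<open>The value is the genuine \<open>j\<close>-fold logarithm only if the iterates of index less than
  \<open>j\<close> are positive: the real function \<open>ln\<close> is total in the library.\<close>

definition iter_log :: "nat \<Rightarrow> real \<Rightarrow> real" where
  "iter_log j x = (ln ^^ j) x"

lemma K_fact_exists:
  "\<exists>K\<ge>1. real (num_divisors (fact (n + K))) / real (num_divisors (fact n)) \<ge> 2"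
proof -
  obtain p :: nat where p: "prime p" "p > n" using bigger_prime by blast
  let ?D = "{k::nat. k dvd fact n}"
  have fin: "finite {k::nat. k dvd fact m}" for m by (simp add: finite_divisors_nat)
  have pos: "card ?D > 0" using fin[of n] by (auto simp: card_gt_0_iff)
  have p0: "p > 0" using p by simp
  have dv: "p * fact n dvd (fact p :: nat)"
  proof -
    have "fact n dvd (fact (p - 1) :: nat)" using p by (intro fact_dvd) simp
    moreover have "(fact p :: nat) = p * fact (p - 1)" using p0 by (simp add: fact_reduce)
    ultimately show ?thesis by (simp add: mult_dvd_mono)
  qed
  have np: "\<not> p dvd (fact n :: nat)" using p by (simp add: prime_dvd_fact_iff)
  have disj: "?D \<inter> (\<lambda>k. p * k) ` ?D = {}"
    using np by (auto dest: dvd_mult_left)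
  have "card (?D \<union> (\<lambda>k. p * k) ` ?D) = 2 * card ?D"
    using disj fin[of n] p0 by (simp add: card_Un_disjoint card_image inj_on_def)
  moreover have "?D \<union> (\<lambda>k. p * k) ` ?D \<subseteq> {k. k dvd fact p}"
    using dv by (auto intro: dvd_trans[OF _ dvd_trans[OF dvd_triv_right dv]]
                             dvd_trans[OF mult_dvd_mono[OF dvd_refl] dv])
  ultimately have "2 * card ?D \<le> card {k::nat. k dvd fact p}"
    using card_mono[OF fin[of p]] by metis
  hence "real (card {k::nat. k dvd fact p}) \<ge> 2 * real (card ?D)" by linarith
  hence "real (num_divisors (fact (n + (p - n)))) / real (num_divisors (fact n)) \<ge> 2"
    using p pos by (simp add: num_divisors_def le_divide_eq)
  thus ?thesis using p by (intro exI[of _ "p - n"]) auto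
qed

end

theory Submission
  imports Defs "HOL-Number_Theory.Number_Theory" "HOL-Real_Asymp.Real_Asymp"
begin

text \<open>
  If \<open>U\<close> is such that \<open>n + 1, \<dots>, n + U\<close> all have small largest prime factor compared with \<open>n\<close>, then
  \<open>d((n + U)!) / d(n!)\<close> is close to 1; quantitatively its logarithm is at most \<open>1/n\<close> times the sum of the
  prime factors, with multiplicity, of these \<open>U\<close> numbers.

  Fix residues of \<open>n\<close> modulo powers of the primes \<open>p \<le> v\<close> as in the Erdos--Rankin construction of large
  prime gaps: middle primes \<open>Y < p \<le> v\<close> divide \<open>n + k\<close> iff they divide \<open>k\<close>, small primes \<open>p \<le> Y\<close> are chosen
  greedily. The modulus \<open>Q\<close> is such that \<open>n + k = g h\<close>, where \<open>g = gcd (n + k, Q)\<close> depends only on \<open>k\<close> and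
  \<open>h\<close> has no prime factor up to \<open>v\<close>. Composite \<open>h\<close> contribute little. For the others let
  \<open>n = b + Q t\<close> with \<open>t\<close> running through an interval of length \<open>T\<close>, where \<open>Q = T\<^bsup>o(1)\<^esup>\<close>: by Selberg's
  sieve \<open>h\<close> is prime with frequency at most about \<open>2 / (ln T \<Prod>\<^bsub>p\<le>v\<^esub> (1 - 1/p))\<close>, so on average they
  contribute that frequency times \<open>\<Sum>\<^bsub>k\<^esub> 1/g\<close>. Unlike for prime gaps no further primes are needed to
  remove the survivors, since those enter \<open>\<Sum>\<^bsub>k\<^esub> 1/g\<close> with weight 1. This loses only constants, and
  crude ones suffice for \<open>3 / (4 * pi\<^sup>2)\<close>.
\<close>

section \<open>Chebyshev and Mertens estimates\<close>

text \<open>The shape of the bound comes from a balance of scales. Write \<open>L = ln T\<close>.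
  Since \<open>Q\<close> contains a power of size at least \<open>U\<close> of every prime up to
  \<open>v\<close>, Chebyshev's bound makes \<open>ln Q\<close> at most of order \<open>v\<close>,
  so \<open>v = o(L)\<close> is needed to keep \<open>ln n\<close> close to \<open>L\<close>.
  Numbers \<open>k \<le> U\<close> without prime factor in \<open>(Y, v]\<close> either have one in
  \<open>(v, U]\<close>, a proportion of about \<open>ln (ln L) / ln L\<close>, or are
  \<open>Y\<close>-smooth. The greedy choice gains the Euler product over \<open>p \<le> Y\<close>,
  the sieve frequency loses the Euler product over \<open>p \<le> v\<close>, and the quotient is
  about \<open>ln v / ln Y\<close>. Hence \<open>Y\<close> is taken as large as it can be with
  smooth numbers still negligible, which makes \<open>ln v / ln Y\<close> of order
  \<open>ln (ln L) / ln (ln (ln L))\<close>. The total is then of order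
  \<open>U * ln (ln L) ^ 2 / (L * ln L * ln (ln (ln L)))\<close>; keeping it below
  \<open>ln 2\<close> fixes the order of \<open>U\<close>.\<close>

lemma prod_primes_dvd:
  fixes m :: nat
  assumes "finite A" "\<And>p. p \<in> A \<Longrightarrow> prime p" "\<And>p. p \<in> A \<Longrightarrow> p dvd m"
  shows "\<Prod>A dvd m"
  using assms
proof (induction A rule: finite_induct)
  case (insert p A)
  have "coprime p (\<Prod>A)"
    using insert.prems(1) insert.hyps by (intro prod_coprime_right) (metis insertCI primes_coprime)
  thus ?case using insert by (simp add: divides_mult)
qed simp

text \<open>Erdos's induction: for \<open>n = 2 * m + 1\<close> the primes in
  \<open>(m + 1, n]\<close> all divide \<open>n choose m\<close>, which occurs twice in a row of
  Pascal's triangle with sum \<open>2 ^ n\<close>, hence is at most \<open>4 ^ m\<close>.\<close>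

lemma primorial_le: "\<Prod>{p. prime p \<and> p \<le> n} \<le> (4::nat) ^ n"
proof (induction n rule: less_induct)
  case (less n)
  consider "n \<le> 1" | "n = 2" | "n > 2" "even n" | "n > 2" "odd n" by linarith
  thus ?case
  proof cases
    case 1
    have "\<not> (prime p \<and> p \<le> n)" for p :: nat using 1 prime_ge_2_nat[of p] by linarith
    hence "{p::nat. prime p \<and> p \<le> n} = {}" by blast
    thus ?thesis by (simp only: prod.empty) simp
  next
    case 2
    have "prime p \<and> p \<le> n \<longleftrightarrow> p = 2" for p :: nat using 2 prime_ge_2_nat[of p] by auto
    hence "{p::nat. prime p \<and> p \<le> n} = {2}" by blast
    thus ?thesis using 2 by simp
  next
    case 3
    have "\<not> prime n" using 3 prime_odd_nat by blast
    hence "p \<le> n \<longleftrightarrow> p \<le> n - 1" if "prime p" for p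
      using 3 that by (cases "p = n") auto
    hence "{p::nat. prime p \<and> p \<le> n} = {p. prime p \<and> p \<le> n - 1}" by blast
    hence "\<Prod>{p::nat. prime p \<and> p \<le> n} \<le> 4 ^ (n - 1)" using less[of "n - 1"] 3 by simp
    also have "\<dots> \<le> 4 ^ n" by (intro power_increasing) auto
    finally show ?thesis .
  next
    case 4
    then obtain m where "n = 2 * m + 1" by (metis oddE)
    hence m: "n = 2 * m + 1" "m \<ge> 1" using 4 by auto
    let ?A = "{p::nat. prime p \<and> p \<le> m + 1}" and ?B = "{p::nat. prime p \<and> m + 1 < p \<and> p \<le> n}"
    have AB: "{p::nat. prime p \<and> p \<le> n} = ?A \<union> ?B" using m by auto
    have "\<Prod>?B dvd (n choose m)"
    proof (rule prod_primes_dvd)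
      fix p assume p: "p \<in> ?B"
      have "fact m * fact (n - m) * (n choose m) = (fact n :: nat)"
        using m by (intro binomial_fact_lemma) auto
      moreover have "p dvd fact n" using p prime_dvd_fact_iff by blast
      moreover have "\<not> p dvd fact m" "\<not> p dvd fact (n - m)"
        using p m by (simp_all add: prime_dvd_fact_iff del: fact_Suc)
      ultimately show "p dvd (n choose m)" using p by (metis (no_types, lifting) mem_Collect_eq prime_dvd_mult_iff)
    qed auto
    hence "\<Prod>?B \<le> (n choose m)" using m by (intro dvd_imp_le) auto
    also have "\<dots> \<le> 4 ^ m"
    proof -
      have "(n choose m) + (n choose (m + 1)) \<le> (\<Sum>k\<le>n. n choose k)"
        using sum_mono2[of "{..n}" "{m, m + 1}" "\<lambda>k. n choose k"] m by simp
      also have "\<dots> = 2 ^ n" by (simp add: choose_row_sum)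
      also have "2 ^ n = (2 * 4 ^ m :: nat)" using m by (simp add: power_mult)
      finally show ?thesis using binomial_symmetric[of m n] m by simp
    qed
    finally have B: "\<Prod>?B \<le> 4 ^ m" .
    have A: "\<Prod>?A \<le> 4 ^ (m + 1)" using less[of "m + 1"] m by simp
    have "\<Prod>{p::nat. prime p \<and> p \<le> n} = \<Prod>?A * \<Prod>?B"
      unfolding AB by (intro prod.union_disjoint) auto
    also have "\<dots> \<le> 4 ^ (m + 1) * 4 ^ m" by (intro mult_mono A B) auto
    also have "\<dots> = 4 ^ n" using m by (simp flip: power_add add: mult_2)
    finally show ?thesis .
  qed
qed

lemma sum_ln_primes_le: "(\<Sum>p | prime p \<and> p \<le> n. ln (real p)) \<le> real n * ln 4"
proof -
  have "(\<Sum>p | prime p \<and> p \<le> n. ln (real p)) = ln (\<Prod>p | prime p \<and> p \<le> n. real p)"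
    by (intro ln_prod [symmetric]) (auto simp: prime_gt_0_nat)
  also have "\<dots> \<le> ln (4 ^ n)"
  proof -
    have "real (\<Prod>{p. prime p \<and> p \<le> n}) \<le> real (4 ^ n)" using primorial_le by (simp only: of_nat_le_iff)
    moreover have "(\<Prod>p | prime p \<and> p \<le> n. real p) > 0" by (intro prod_pos) (auto simp: prime_gt_0_nat)
    ultimately show ?thesis by simp
  qed
  finally show ?thesis by (simp add: ln_realpow)
qed

section \<open>Multiplicities and Legendre's formula\<close>

lemma card_multiples:
  assumes "d > 0"
  shows "card {m \<in> {1..n}. d dvd m} = n div d"
proof -
  have "{m \<in> {1..n}. d dvd m} = (\<lambda>i. d * i) ` {1..n div d}"
  proof (intro equalityI subsetI)
    fix m assume "m \<in> {m \<in> {1..n}. d dvd m}"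
    then obtain i where "m = d * i" "1 \<le> d * i" "d * i \<le> n" by auto
    hence "i \<in> {1..n div d}"
      using assms less_eq_div_iff_mult_less_eq[of d i n] by (cases i) (auto simp: mult.commute)
    thus "m \<in> (\<lambda>i. d * i) ` {1..n div d}" using \<open>m = d * i\<close> by blast
  next
    fix m assume "m \<in> (\<lambda>i. d * i) ` {1..n div d}"
    then obtain i where "m = d * i" "i \<in> {1..n div d}" by blast
    hence "m = d * i" "1 \<le> i" "i \<le> n div d" by auto
    thus "m \<in> {m \<in> {1..n}. d dvd m}"
      using assms less_eq_div_iff_mult_less_eq[of d i n] by (simp add: mult.commute)
  qed
  thus ?thesis using assms by (simp add: card_image inj_on_def)
qed

lemma multiplicity_less:
  fixes p n :: nat
  assumes "prime p" "n > 0"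
  shows "multiplicity p n < n"
proof -
  have "multiplicity p n < p ^ multiplicity p n"
    using prime_gt_1_nat[OF assms(1)] by (intro power_gt_expt) simp
  also have "\<dots> \<le> n" using assms(2) by (intro dvd_imp_le multiplicity_dvd)
  finally show ?thesis .
qed

lemma multiplicity_eq_sum:
  fixes p m N :: nat
  assumes "prime p" "m > 0" "m \<le> N"
  shows "multiplicity p m = (\<Sum>j\<in>{1..N}. if p ^ j dvd m then 1 else 0)"
proof -
  have "multiplicity p m < m" using assms(1,2) by (rule multiplicity_less)
  moreover have "p ^ j dvd m \<longleftrightarrow> j \<le> multiplicity p m" for j
    using assms by (intro power_dvd_iff_le_multiplicity) (auto simp: not_prime_unit)
  ultimately have "{j \<in> {1..N}. p ^ j dvd m} = {1..multiplicity p m}"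
    using assms(3) by (simp add: set_eq_iff) linarith
  thus ?thesis by (simp add: sum.If_cases Int_def)
qed

lemma nat_eq_prod_multiplicity:
  fixes n :: nat
  assumes "n > 0" "finite A" "\<And>p. p \<in> A \<Longrightarrow> prime p" "prime_factors n \<subseteq> A"
  shows "n = (\<Prod>p\<in>A. p ^ multiplicity p n)"
proof -
  have "n = (\<Prod>p\<in>prime_factors n. p ^ multiplicity p n)"
    using assms(1) by (intro prime_factorization_nat)
  also have "\<dots> = (\<Prod>p\<in>A. p ^ multiplicity p n)"
  proof (rule prod.mono_neutral_left[OF assms(2,4)], safe)
    fix p assume "p \<in> A" "p \<notin> prime_factors n"
    hence "\<not> p dvd n" using assms(1,3) by (auto simp: prime_factors_dvd)
    thus "p ^ multiplicity p n = 1" by (simp add: not_dvd_imp_multiplicity_0)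
  qed
  finally show ?thesis .
qed

text \<open>Legendre's formula. Stopping the sum at \<open>n\<close> loses nothing, as
  \<open>p ^ j > n\<close> for \<open>j > n\<close>.\<close>

lemma multiplicity_fact:
  assumes "prime p"
  shows "multiplicity p (fact n :: nat) = (\<Sum>j\<in>{1..n}. n div p ^ j)"
proof -
  have "multiplicity p (fact n :: nat) = (\<Sum>m\<in>{1..n}. multiplicity p m)"
    unfolding fact_prod of_nat_id using assms by (subst prime_elem_multiplicity_prod_distrib) auto
  also have "\<dots> = (\<Sum>m\<in>{1..n}. \<Sum>j\<in>{1..n}. if p ^ j dvd m then 1 else 0)"
    using assms by (intro sum.cong refl multiplicity_eq_sum) auto
  also have "\<dots> = (\<Sum>j\<in>{1..n}. \<Sum>m\<in>{1..n}. if p ^ j dvd m then 1 else 0)"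
    by (rule sum.swap)
  also have "\<dots> = (\<Sum>j\<in>{1..n}. n div p ^ j)"
  proof (intro sum.cong refl)
    fix j
    have "(\<Sum>m\<in>{1..n}. if p ^ j dvd m then 1 else 0) = card {m \<in> {1..n}. p ^ j dvd m}"
      by (simp add: sum.If_cases Int_def)
    thus "(\<Sum>m\<in>{1..n}. if p ^ j dvd m then 1 else 0) = n div p ^ j"
      using assms by (simp only: card_multiples prime_gt_0_nat zero_less_power)
  qed
  finally show ?thesis .
qed

section \<open>Mertens' theorems\<close>

lemma ln_fact_eq:
  "ln (fact n) = (\<Sum>p | prime p \<and> p \<le> n. real (multiplicity p (fact n :: nat)) * ln (real p))"
proof -
  have "(fact n :: nat) = (\<Prod>p\<in>prime_factors (fact n). p ^ multiplicity p (fact n))"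
    by (rule prime_factorization_nat) simp
  also have "prime_factors (fact n :: nat) = {p. prime p \<and> p \<le> n}"
    by (auto simp: prime_factors_dvd prime_dvd_fact_iff)
  finally have "real (fact n) = real (\<Prod>p | prime p \<and> p \<le> n. p ^ multiplicity p (fact n))" by simp
  hence "(fact n :: real) = (\<Prod>p | prime p \<and> p \<le> n. real p ^ multiplicity p (fact n :: nat))"
    by simp
  also have "ln \<dots> = (\<Sum>p | prime p \<and> p \<le> n. ln (real p ^ multiplicity p (fact n :: nat)))"
    by (intro ln_prod) (auto simp: prime_gt_0_nat)
  finally show ?thesis by (simp add: ln_realpow prime_gt_0_nat)
qed

lemma ln_fact_le: "ln (fact n) \<le> real n * ln (real n)"
proof (cases "n = 0")
  case False
  have "fact n \<le> real n ^ n" by (metis fact_le_power le_refl of_nat_fact of_nat_power)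
  hence "ln (fact n) \<le> ln (real n ^ n)" using False by simp
  thus ?thesis using False by (simp add: ln_realpow)
qed simp

lemma ln_fact_ge: "ln (fact n) \<ge> real n * ln (real n) - real n"
proof (induction n)
  case (Suc n)
  show ?case
  proof (cases "n = 0")
    case False
    have "real n * (ln (real (Suc n)) - ln (real n)) \<le> 1"
    proof -
      have "ln (real (Suc n) / real n) \<le> real (Suc n) / real n - 1" using False by (intro ln_le_minus_one) auto
      hence "ln (real (Suc n)) - ln (real n) \<le> 1 / real n" using False by (simp add: ln_div field_simps)
      thus ?thesis using False by (simp add: field_simps)
    qed
    moreover have "ln (fact (Suc n) :: real) = ln (real (Suc n)) + ln (fact n)"
      using False by (simp only: fact_Suc of_nat_mult of_nat_fact) (subst ln_mult, auto)
    ultimately show ?thesis using Suc by (simp add: algebra_simps)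
  qed auto
qed simp

lemma sum_power_inverse_le:
  fixes q :: real
  assumes "q > 1"
  shows "(\<Sum>j\<in>{0..N}. (1 / q) ^ j) \<le> q / (q - 1)" "(\<Sum>j\<in>{1..N}. (1 / q) ^ j) \<le> 1 / (q - 1)"
proof -
  have *: "(\<Sum>j\<in>{0..N}. (1 / q) ^ j) = (q - (1 / q) ^ N) / (q - 1)"
  proof (induction N)
    case 0
    show ?case using assms by simp
  next
    case (Suc m)
    have "(1 / q) ^ Suc m = ((1 / q) ^ m - (1 / q) ^ Suc m) / (q - 1)"
      using assms by (simp add: field_simps)
    hence "(\<Sum>j\<in>{0..Suc m}. (1 / q) ^ j) =
        (q - (1 / q) ^ m) / (q - 1) + ((1 / q) ^ m - (1 / q) ^ Suc m) / (q - 1)"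
      using Suc by simp
    thus ?case by (simp only: add_divide_distrib [symmetric]) simp
  qed
  also have "\<dots> \<le> q / (q - 1)" using assms by (intro divide_right_mono) auto
  finally show 1: "(\<Sum>j\<in>{0..N}. (1 / q) ^ j) \<le> q / (q - 1)" .
  have "(\<Sum>j\<in>{1..N}. (1 / q) ^ j) = (\<Sum>j\<in>{0..N}. (1 / q) ^ j) - 1"
    by (simp add: sum.atLeast_Suc_atMost[of 0])
  also have "\<dots> \<le> q / (q - 1) - 1" using 1 by simp
  also have "\<dots> = 1 / (q - 1)" using assms by (simp add: field_simps)
  finally show "(\<Sum>j\<in>{1..N}. (1 / q) ^ j) \<le> 1 / (q - 1)" .
qed

text \<open>Mertens' first theorem: \<open>ln (fact n)\<close> is known by size and by Legendre's
  formula. Keeping only the term \<open>j = 1\<close> gives the upper bound, where the rounding of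
  \<open>n / p\<close> costs a Chebyshev sum. Keeping the whole geometric series gives the lower
  bound, where its excess over \<open>1 / p\<close> is summable.\<close>

lemma sum_ln_over_prime_bounds:
  assumes "n \<ge> 1"
  shows "\<bar>(\<Sum>p | prime p \<and> p \<le> n. ln (real p) / real p) - ln (real n)\<bar> \<le> 3"
proof -
  let ?P = "{p::nat. prime p \<and> p \<le> n}"
  define M where "M = (\<Sum>p\<in>?P. ln (real p) / real p)"
  have n: "real n > 0" using assms by simp
  have pge: "real p \<ge> 2" if "p \<in> ?P" for p using that prime_ge_2_nat by force
  have upper: "M \<le> ln (real n) + ln 4"
  proof -
    have "real n * M - real n * ln 4 \<le> real n * M - (\<Sum>p\<in>?P. ln (real p))"
      using sum_ln_primes_le[of n] by simp
    also have "\<dots> = (\<Sum>p\<in>?P. (real n / real p - 1) * ln (real p))"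
      unfolding M_def by (simp add: sum_distrib_left sum_subtractf algebra_simps)
    also have "\<dots> \<le> (\<Sum>p\<in>?P. real (multiplicity p (fact n :: nat)) * ln (real p))"
    proof (intro sum_mono mult_right_mono)
      fix p assume p: "p \<in> ?P"
      have "real n / real p - 1 \<le> real (n div p)"
      proof -
        have "n < (n div p + 1) * p" using dividend_less_div_times[of p n] p prime_gt_0_nat by (simp add: add.commute)
        hence "real n < (real (n div p) + 1) * real p" by (metis of_nat_1 of_nat_add of_nat_less_iff of_nat_mult)
        thus ?thesis using pge[OF p] by (simp add: field_simps)
      qed
      also have "n div p \<le> multiplicity p (fact n)"
        using p assms member_le_sum[of 1 "{1..n}" "\<lambda>j. n div p ^ j"] by (simp add: multiplicity_fact)
      finally show "real n / real p - 1 \<le> real (multiplicity p (fact n :: nat))" by simp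
      show "0 \<le> ln (real p)" using pge[OF p] by simp
    qed
    also have "\<dots> = ln (fact n)" by (rule ln_fact_eq [symmetric])
    also have "\<dots> \<le> real n * ln (real n)" by (rule ln_fact_le)
    finally have "real n * M \<le> real n * (ln (real n) + ln 4)" by (simp add: algebra_simps)
    thus ?thesis using n by simp
  qed
  have lower: "M \<ge> ln (real n) - 3"
  proof -
    have "real n * ln (real n) - real n \<le> ln (fact n)" by (rule ln_fact_ge)
    also have "\<dots> = (\<Sum>p\<in>?P. real (multiplicity p (fact n :: nat)) * ln (real p))" by (rule ln_fact_eq)
    also have "\<dots> \<le> (\<Sum>p\<in>?P. real n / (real p - 1) * ln (real p))"
    proof (intro sum_mono mult_right_mono)
      fix p assume p: "p \<in> ?P"
      have "real (multiplicity p (fact n :: nat)) = (\<Sum>j\<in>{1..n}. real (n div p ^ j))"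
        using p by (simp add: multiplicity_fact)
      also have "\<dots> \<le> (\<Sum>j\<in>{1..n}. real n * (1 / real p) ^ j)"
      proof (intro sum_mono)
        fix j
        have "real (n div p ^ j) \<le> real n / real (p ^ j)" by (rule of_nat_div_le_of_nat)
        thus "real (n div p ^ j) \<le> real n * (1 / real p) ^ j" by (simp add: power_divide)
      qed
      also have "\<dots> = real n * (\<Sum>j\<in>{1..n}. (1 / real p) ^ j)" by (simp add: sum_distrib_left)
      also have "(\<Sum>j\<in>{1..n}. (1 / real p) ^ j) \<le> 1 / (real p - 1)"
        using pge[OF p] by (intro sum_power_inverse_le) auto
      finally show "real (multiplicity p (fact n :: nat)) \<le> real n / (real p - 1)"
        using n by simp
      show "0 \<le> ln (real p)" using pge[OF p] by simp
    qed
    also have "\<dots> = real n * M + real n * (\<Sum>p\<in>?P. ln (real p) / (real p * (real p - 1)))"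
      unfolding M_def sum_distrib_left sum.distrib [symmetric]
    proof (intro sum.cong refl)
      fix p assume "p \<in> ?P"
      from pge[OF this] show "real n / (real p - 1) * ln (real p) =
          real n * (ln (real p) / real p) + real n * (ln (real p) / (real p * (real p - 1)))"
        by (simp add: divide_simps) (simp add: algebra_simps)
    qed
    also have "(\<Sum>p\<in>?P. ln (real p) / (real p * (real p - 1))) \<le> 2"
    proof -
      have "(\<Sum>p\<in>?P. ln (real p) / (real p * (real p - 1))) \<le> (\<Sum>m\<in>{2..n}. ln (real m) / (real m * (real m - 1)))"
        using prime_ge_2_nat by (intro sum_mono2) auto
      \<comment> \<open>\<open>-(ln x + 1) / x\<close> is an antiderivative of
        \<open>ln x / x ^ 2\<close>; having \<open>2\<close> in place of \<open>1\<close> leaves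
        room for the discretisation.\<close>
      also have "\<dots> \<le> 2 - (ln (real n) + 2) / real n" using assms
      proof (induction n rule: dec_induct)
        case (step m)
        have *: "ln (real (Suc m)) / (real (Suc m) * real m) \<le> (ln (real m) + 2) / real m - (ln (real (Suc m)) + 2) / real (Suc m)"
        proof -
          have m: "real m \<ge> 1" using step by simp
          have "ln (real (Suc m) / real m) \<le> real (Suc m) / real m - 1" using m by (intro ln_le_minus_one) auto
          hence "ln (real (Suc m)) - ln (real m) \<le> 1 / real m" using m by (simp add: ln_div field_simps)
          hence "real (Suc m) * (ln (real (Suc m)) - ln (real m)) \<le> real (Suc m) * (1 / real m)"
            by (intro mult_left_mono) auto
          also have "\<dots> \<le> 2" using m by (simp add: field_simps)
          finally have "ln (real (Suc m)) \<le> (ln (real m) + 2) * real (Suc m) - (ln (real (Suc m)) + 2) * real m"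
            by (simp add: algebra_simps)
          hence "ln (real (Suc m)) / (real (Suc m) * real m) \<le> ((ln (real m) + 2) * real (Suc m) - (ln (real (Suc m)) + 2) * real m) / (real (Suc m) * real m)"
            by (intro divide_right_mono) auto
          also have "\<dots> = (ln (real m) + 2) / real m - (ln (real (Suc m)) + 2) / real (Suc m)"
            using m by (simp add: divide_simps)
          finally show ?thesis .
        qed
        show ?case using step.IH * step.hyps by (simp add: sum.atLeast_Suc_atMost atLeastAtMostSuc_conv)
      qed simp
      also have "\<dots> \<le> 2" using assms by simp
      finally show ?thesis .
    qed
    finally have "real n * ln (real n) - real n \<le> real n * M + real n * 2" using n by simp
    hence "real n * (ln (real n) - 3) \<le> real n * M" by (simp add: algebra_simps)
    thus ?thesis using n by simp
  qed
  have "ln 4 \<le> (3::real)" by (rule order_trans[OF ln_le_minus_one]) auto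
  thus ?thesis using upper lower unfolding M_def by linarith
qed

text \<open>Mertens' second theorem, from the first by Abel summation.\<close>

lemma sum_inverse_primes_le:
  assumes "2 \<le> a" "a \<le> b"
  shows "(\<Sum>p | prime p \<and> a < p \<and> p \<le> b. 1 / real p) \<le> ln (ln (real b) / ln (real a)) + 6 / ln (real a)"
proof -
  define A where "A n = (\<Sum>p | prime p \<and> p \<le> n. ln (real p) / real p) - ln (real n)" for n
  have A: "\<bar>A n\<bar> \<le> 3" if "n \<ge> 1" for n using sum_ln_over_prime_bounds[OF that] by (simp add: A_def)
  \<comment> \<open>Abel summation phrased as an induction on \<open>b\<close>: the terms with
    \<open>A\<close> are the boundary terms, and the last one bounds the integral of the error
    \<open>A\<close>, at most \<open>3\<close> in absolute value, against the derivative of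
    \<open>-1 / ln\<close>.\<close>
  have "(\<Sum>p | prime p \<and> a < p \<and> p \<le> b. 1 / real p) \<le>
     ln (ln (real b)) - ln (ln (real a)) + A b / ln (real b) - A a / ln (real a) + 3 * (1 / ln (real a) - 1 / ln (real b))"
    using assms(2)
  proof (induction b rule: dec_induct)
    case base
    have "{p. prime p \<and> a < p \<and> p \<le> a} = {}" by auto
    thus ?case by (simp only: sum.empty) simp
  next
    case (step b)
    define t where "t = (if prime (Suc b) then 1 / real (Suc b) else 0)"
    let ?l = "ln (real b)" and ?l' = "ln (real (Suc b))"
    have b: "real b \<ge> 2" using step assms by simp
    have l: "?l > 0" "?l' > 0" "?l < ?l'" using b by auto
    have 1: "(\<Sum>p | prime p \<and> a < p \<and> p \<le> Suc b. 1 / real p) = (\<Sum>p | prime p \<and> a < p \<and> p \<le> b. 1 / real p) + t"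
    proof -
      have "{p. prime p \<and> a < p \<and> p \<le> Suc b} = (if prime (Suc b) then insert (Suc b) {p. prime p \<and> a < p \<and> p \<le> b} else {p. prime p \<and> a < p \<and> p \<le> b})"
        using step by (auto simp: le_Suc_eq)
      thus ?thesis by (simp add: t_def)
    qed
    have 2: "t * ?l' = A (Suc b) - A b + ?l' - ?l"
    proof -
      have "{p. prime p \<and> p \<le> Suc b} = (if prime (Suc b) then insert (Suc b) {p. prime p \<and> p \<le> b} else {p. prime p \<and> p \<le> b})"
        by (auto simp: le_Suc_eq)
      thus ?thesis by (simp add: t_def A_def)
    qed
    have 3: "1 - ?l / ?l' \<le> ln ?l' - ln ?l"
    proof -
      have "ln (?l / ?l') \<le> ?l / ?l' - 1" using l by (intro ln_le_minus_one) auto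
      thus ?thesis using l by (simp add: ln_div)
    qed
    have 4: "t = A (Suc b) / ?l' - A b / ?l' + (1 - ?l / ?l')"
    proof -
      have "t * ?l' = (A (Suc b) / ?l' - A b / ?l' + (1 - ?l / ?l')) * ?l'"
        using 2 l by (simp add: algebra_simps)
      thus ?thesis using l by simp
    qed
    have 5: "A b * (1 / ?l - 1 / ?l') \<le> 3 * (1 / ?l - 1 / ?l')"
      using A[of b] b l by (intro mult_right_mono) (auto simp: field_simps)
    have 6: "A b * (1 / ?l - 1 / ?l') = A b / ?l - A b / ?l'" by (simp add: algebra_simps)
    show ?case using step.IH 1 3 4 5 6 by (simp add: algebra_simps)
  qed
  moreover have "A b / ln (real b) \<le> 3 / ln (real b)"
    using A[of b] assms by (intro divide_right_mono) auto
  moreover have "- A a / ln (real a) \<le> 3 / ln (real a)"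
    using A[of a] assms by (intro divide_right_mono) auto
  ultimately have "(\<Sum>p | prime p \<and> a < p \<and> p \<le> b. 1 / real p) \<le> ln (ln (real b)) - ln (ln (real a)) + 6 / ln (real a)"
    by (simp add: algebra_simps)
  also have "ln (ln (real b)) - ln (ln (real a)) = ln (ln (real b) / ln (real a))"
    using assms by (simp add: ln_div)
  finally show ?thesis .
qed

text \<open>Take logarithms: \<open>-ln (1 - x) \<le> x + 2 * x ^ 2\<close> for
  \<open>0 \<le> x \<le> 1 / 2\<close>. The linear terms are Mertens' sum and the squares telescope
  to at most \<open>1 / a\<close>.\<close>

lemma prod_primes_inverse_le:
  assumes "2 \<le> a" "a \<le> b"
  shows "(\<Prod>p | prime p \<and> a < p \<and> p \<le> b. real p / (real p - 1))
           \<le> ln (real b) / ln (real a) * exp (6 / ln (real a) + 2 / real a)"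
proof -
  let ?P = "{p. prime p \<and> a < p \<and> p \<le> b}"
  have sq: "(\<Sum>p\<in>{a<..b}. 1 / real p ^ 2) \<le> 1 / real a - 1 / real b"
    using assms(2)
  proof (induction b rule: dec_induct)
    case (step b)
    have "1 / real (Suc b) ^ 2 \<le> 1 / real b - 1 / real (Suc b)"
    proof -
      have b: "real b > 0" using step assms by simp
      have "1 / real (Suc b) ^ 2 \<le> 1 / (real b * real (Suc b))"
        unfolding power2_eq_square using b by (intro divide_left_mono mult_right_mono) auto
      also have "\<dots> = 1 / real b - 1 / real (Suc b)" using b by (simp add: divide_simps)
      finally show ?thesis .
    qed
    moreover have "{a<..Suc b} = insert (Suc b) {a<..b}" using step by auto
    ultimately show ?case using step by simp
  qed simp
  have "(\<Prod>p\<in>?P. real p / (real p - 1)) \<le> (\<Prod>p\<in>?P. exp (1 / real p + 2 * (1 / real p ^ 2)))"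
  proof (intro prod_mono conjI)
    fix p assume p: "p \<in> ?P"
    hence p2: "real p > 2" using assms by auto
    thus "0 \<le> real p / (real p - 1)" by simp
    have "- (1 / real p) - 2 * (1 / real p)\<^sup>2 \<le> ln (1 - 1 / real p)"
      using p2 by (intro ln_one_minus_pos_lower_bound) (auto simp: field_simps)
    also have "ln (1 - 1 / real p) = - ln (real p / (real p - 1))"
      using p2 by (simp add: field_simps ln_div flip: ln_inverse)
    finally have "ln (real p / (real p - 1)) \<le> 1 / real p + 2 * (1 / real p ^ 2)" by (simp add: power_divide)
    thus "real p / (real p - 1) \<le> exp (1 / real p + 2 * (1 / real p ^ 2))"
      using p2 by (metis divide_pos_pos exp_le_cancel_iff exp_ln less_trans zero_less_numeral diff_gt_0_iff_gt one_less_numeral_iff semiring_norm(76))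
  qed
  also have "\<dots> = exp ((\<Sum>p\<in>?P. 1 / real p) + 2 * (\<Sum>p\<in>?P. 1 / real p ^ 2))"
    by (simp add: exp_sum [symmetric] sum.distrib sum_distrib_left)
  also have "\<dots> \<le> exp (ln (ln (real b) / ln (real a)) + 6 / ln (real a) + 2 * (1 / real a))"
  proof -
    have "(\<Sum>p\<in>?P. 1 / real p ^ 2) \<le> (\<Sum>p\<in>{a<..b}. 1 / real p ^ 2)" by (intro sum_mono2) auto
    also have "\<dots> \<le> 1 / real a" using sq by (rule order_trans) simp
    finally show ?thesis using sum_inverse_primes_le[OF assms] by (subst exp_le_cancel_iff) linarith
  qed
  also have "\<dots> = ln (real b) / ln (real a) * exp (6 / ln (real a) + 2 / real a)"
    using assms by (simp add: exp_add)
  finally show ?thesis .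
qed

section \<open>Selberg's sieve\<close>

text \<open>Expansion of an Euler product: \<open>n\<close> is determined by its exponents at the
  primes in \<open>A\<close>. At primes of \<open>X\<close> the exponent is at least 1, so that
  their geometric series starts at \<open>j = 1\<close> and contributes
  \<open>1 / (p - 1)\<close>.\<close>

lemma sum_inverse_prime_factors_le:
  assumes "finite A" "\<And>p. p \<in> A \<Longrightarrow> prime p" "X \<subseteq> A"
  shows "(\<Sum>n | n \<in> {1..N} \<and> X \<subseteq> prime_factors n \<and> prime_factors n \<subseteq> A. 1 / real n)
           \<le> (\<Prod>p\<in>A - X. real p / (real p - 1)) * (\<Prod>p\<in>X. 1 / (real p - 1))"
proof -
  let ?S = "{n. n \<in> {1..N} \<and> X \<subseteq> prime_factors n \<and> prime_factors n \<subseteq> A}"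
  define J where "J p = (if p \<in> X then {1..N} else {0..N})" for p
  define \<phi> where "\<phi> n = restrict (\<lambda>p. multiplicity p n) A" for n :: nat
  have eq: "n = (\<Prod>p\<in>A. p ^ \<phi> n p)" if "n \<in> ?S" for n
    unfolding \<phi>_def using that assms nat_eq_prod_multiplicity[of n A] by (simp cong: prod.cong)
  have inj: "inj_on \<phi> ?S"
  proof (rule inj_onI)
    fix m n assume "m \<in> ?S" "n \<in> ?S" "\<phi> m = \<phi> n"
    thus "m = n" using eq[of m] eq[of n] by presburger
  qed
  have sub: "\<phi> ` ?S \<subseteq> Pi\<^sub>E A J"
  proof (rule image_subsetI)
    fix n assume "n \<in> ?S"
    hence n: "n \<in> {1..N}" "X \<subseteq> prime_factors n" "prime_factors n \<subseteq> A" by auto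
    show "\<phi> n \<in> Pi\<^sub>E A J"
    proof (rule PiE_I)
      fix p assume p: "p \<in> A"
      have "multiplicity p n \<le> N" using multiplicity_less[OF assms(2)[OF p], of n] n by simp
      moreover have "multiplicity p n \<ge> 1" if "p \<in> X"
        using that n assms(2)[OF p] by (metis One_nat_def Suc_leI in_mono prime_factors_multiplicity mem_Collect_eq)
      ultimately show "\<phi> n p \<in> J p" using p by (auto simp: \<phi>_def J_def)
    qed (simp add: \<phi>_def)
  qed
  have finJ: "finite (J p)" for p by (simp add: J_def)
  have "(\<Sum>n\<in>?S. 1 / real n) = (\<Sum>n\<in>?S. \<Prod>p\<in>A. (1 / real p) ^ \<phi> n p)"
  proof (rule sum.cong [OF refl])
    fix n assume "n \<in> ?S"
    hence "real n = (\<Prod>p\<in>A. real p ^ \<phi> n p)" using eq[of n] by (metis (no_types, lifting) of_nat_power of_nat_prod prod.cong)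
    thus "1 / real n = (\<Prod>p\<in>A. (1 / real p) ^ \<phi> n p)" by (simp add: power_divide prod_dividef)
  qed
  also have "\<dots> = (\<Sum>g\<in>\<phi> ` ?S. \<Prod>p\<in>A. (1 / real p) ^ g p)"
    by (subst sum.reindex[OF inj]) (simp only: o_def)
  also have "\<dots> \<le> (\<Sum>g\<in>Pi\<^sub>E A J. \<Prod>p\<in>A. (1 / real p) ^ g p)"
    using sub assms(1) finJ by (intro sum_mono2 finite_PiE prod_nonneg) auto
  also have "\<dots> = (\<Prod>p\<in>A. \<Sum>j\<in>J p. (1 / real p) ^ j)"
    using assms(1) finJ by (intro prod_sum_PiE [symmetric]) auto
  also have "\<dots> \<le> (\<Prod>p\<in>A. if p \<in> X then 1 / (real p - 1) else real p / (real p - 1))"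
  proof (intro prod_mono conjI)
    fix p assume p: "p \<in> A"
    have "real p > 1" using assms(2)[OF p] prime_gt_1_nat by simp
    thus "(\<Sum>j\<in>J p. (1 / real p) ^ j) \<le> (if p \<in> X then 1 / (real p - 1) else real p / (real p - 1))"
      using sum_power_inverse_le[of "real p" N] by (simp only: J_def split: if_splits) auto
  qed (auto intro!: sum_nonneg)
  also have "\<dots> = (\<Prod>p\<in>A - X. real p / (real p - 1)) * (\<Prod>p\<in>X. 1 / (real p - 1))"
    using assms(1,3) by (subst prod.If_cases) (auto simp: Int_absorb1 Int_absorb2 Diff_eq mult.commute Int_commute)
  finally show ?thesis .
qed

lemma ln_le_prod_primes:
  "ln (real n + 1) \<le> (\<Prod>p | prime p \<and> p \<le> n. real p / (real p - 1))"
proof -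
  have "ln (real n + 1) \<le> harm n" by (rule ln_le_harm)
  also have "\<dots> = (\<Sum>m | m \<in> {1..n} \<and> {} \<subseteq> prime_factors m \<and> prime_factors m \<subseteq> {p. prime p \<and> p \<le> n}. 1 / real m)"
  proof -
    have "{m. m \<in> {1..n} \<and> {} \<subseteq> prime_factors m \<and> prime_factors m \<subseteq> {p. prime p \<and> p \<le> n}} = {1..n}"
      by (auto simp: prime_factors_dvd dest!: dvd_imp_le)
    thus ?thesis by (simp add: harm_def inverse_eq_divide)
  qed
  also have "\<dots> \<le> (\<Prod>p\<in>{p. prime p \<and> p \<le> n} - {}. real p / (real p - 1)) * (\<Prod>p\<in>{}. 1 / (real p - 1))"
    by (rule sum_inverse_prime_factors_le) auto
  finally show ?thesis by simp
qed

text \<open>A squarefree sieve modulus is represented by the set of its prime factors, so that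
  divisors, gcd and lcm become subsets, intersections and unions.\<close>

definition sieve_moduli :: "nat \<Rightarrow> nat \<Rightarrow> nat set set" where
  "sieve_moduli v D = {X. X \<subseteq> {p. prime p \<and> v < p \<and> p \<le> D} \<and> \<Prod>X \<le> D}"

lemma sieve_moduliD:
  assumes "X \<in> sieve_moduli v D"
  shows "finite X" "\<And>p. p \<in> X \<Longrightarrow> prime p" "\<And>p. p \<in> X \<Longrightarrow> v < p" "\<Prod>X \<le> D"
proof -
  have "finite {p. prime p \<and> v < p \<and> p \<le> D}" by simp
  thus "finite X" "\<And>p. p \<in> X \<Longrightarrow> prime p" "\<And>p. p \<in> X \<Longrightarrow> v < p" "\<Prod>X \<le> D"
    using assms by (auto simp: sieve_moduli_def intro: finite_subset)
qed

lemma finite_sieve_moduli [simp]: "finite (sieve_moduli v D)"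
proof -
  have "sieve_moduli v D \<subseteq> Pow {p. prime p \<and> v < p \<and> p \<le> D}" by (auto simp: sieve_moduli_def)
  thus ?thesis by (rule finite_subset) simp
qed

lemma sieve_moduli_subset:
  assumes "X \<in> sieve_moduli v D" "Z \<subseteq> X"
  shows "Z \<in> sieve_moduli v D"
proof -
  have "\<Prod>Z dvd \<Prod>X" using assms sieve_moduliD[OF assms(1)] by (intro prod_dvd_prod_subset) auto
  moreover have "\<Prod>X > 0" using sieve_moduliD[OF assms(1)] by (intro prod_pos) (auto simp: prime_gt_0_nat)
  ultimately have "\<Prod>Z \<le> \<Prod>X" by (intro dvd_imp_le)
  thus ?thesis using assms by (auto simp: sieve_moduli_def)
qed

text \<open>The sum of \<open>1 / \<phi>(d)\<close> over squarefree \<open>d \<le> D\<close> with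
  all prime factors above \<open>v\<close>. Its reciprocal is the minimum of Selberg's quadratic
  form.\<close>

definition sieve_density :: "nat \<Rightarrow> nat \<Rightarrow> real" where
  "sieve_density v D = (\<Sum>X\<in>sieve_moduli v D. \<Prod>p\<in>X. 1 / (real p - 1))"

text \<open>Group the harmonic sum up to \<open>D\<close> by the set \<open>X\<close> of prime
  factors above \<open>v\<close>. The other factors of a number in the class of \<open>X\<close> are
  primes up to \<open>v\<close> and repetitions of primes in \<open>X\<close>, so the class
  contributes at most the small Euler product times the summand of \<open>X\<close> in
  \<open>sieve_density\<close>.\<close>

lemma ln_le_sieve_density:
  "ln (real D + 1) \<le> (\<Prod>p | prime p \<and> p \<le> v. real p / (real p - 1)) * sieve_density v D"
proof -
  let ?A = "{p. prime p \<and> p \<le> v}"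
  let ?S = "\<lambda>X. {n. n \<in> {1..D} \<and> X \<subseteq> prime_factors n \<and> prime_factors n \<subseteq> ?A \<union> X}"
  have "ln (real D + 1) \<le> harm D" by (rule ln_le_harm)
  also have "\<dots> = (\<Sum>n\<in>{1..D}. 1 / real n)" by (simp add: harm_def inverse_eq_divide)
  also have "\<dots> = (\<Sum>X\<in>sieve_moduli v D. \<Sum>n | n \<in> {1..D} \<and> prime_factors n - ?A = X. 1 / real n)"
  proof (rule sum.group [symmetric])
    show "(\<lambda>n. prime_factors n - ?A) ` {1..D} \<subseteq> sieve_moduli v D"
    proof safe
      fix n assume n: "n \<in> {1..D}"
      let ?X = "prime_factors n - ?A"
      have "\<Prod>?X dvd n" by (rule prod_primes_dvd) (auto simp: prime_factors_dvd)
      hence "\<Prod>?X \<le> D" using n by (auto dest!: dvd_imp_le)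
      moreover have "p \<le> D" if "p \<in> prime_factors n" for p
        using that n by (auto simp: prime_factors_dvd dest!: dvd_imp_le)
      ultimately show "?X \<in> sieve_moduli v D" by (auto simp: sieve_moduli_def)
    qed
  qed auto
  also have "\<dots> \<le> (\<Sum>X\<in>sieve_moduli v D. \<Sum>n\<in>?S X. 1 / real n)"
  proof (intro sum_mono sum_mono2 subsetI)
    fix X n assume "n \<in> {n \<in> {1..D}. prime_factors n - ?A = X}"
    thus "n \<in> ?S X" by blast
  qed simp_all
  also have "\<dots> \<le> (\<Sum>X\<in>sieve_moduli v D. (\<Prod>p\<in>?A. real p / (real p - 1)) * (\<Prod>p\<in>X. 1 / (real p - 1)))"
  proof (rule sum_mono)
    fix X assume X: "X \<in> sieve_moduli v D"
    note X' = sieve_moduliD[OF X]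
    have "(\<Sum>n\<in>?S X. 1 / real n) \<le> (\<Prod>p\<in>?A \<union> X - X. real p / (real p - 1)) * (\<Prod>p\<in>X. 1 / (real p - 1))"
      by (rule sum_inverse_prime_factors_le) (use X'(1,2) in simp_all, blast)
    moreover have "?A \<union> X - X = ?A"
    proof -
      have "p \<notin> X" if "p \<in> ?A" for p using X'(3)[of p] that by (simp, linarith)
      thus ?thesis by blast
    qed
    ultimately show "(\<Sum>n\<in>?S X. 1 / real n) \<le> (\<Prod>p\<in>?A. real p / (real p - 1)) * (\<Prod>p\<in>X. 1 / (real p - 1))"
      by (simp only:)
  qed
  finally show ?thesis by (simp add: sieve_density_def sum_distrib_left)
qed

text \<open>Moebius inversion on the subset lattice: up to the factor \<open>(-1) ^ card L\<close>
  the sum is the expansion of \<open>(-1 + 1) ^ card (R - L)\<close>.\<close>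

lemma sum_alternating_between:
  assumes "finite R" "L \<subseteq> R"
  shows "(\<Sum>X | L \<subseteq> X \<and> X \<subseteq> R. (-1) ^ card X) = (if L = R then (-1) ^ card L else (0::real))"
proof -
  have fin: "finite L" using assms finite_subset by blast
  have "(\<Sum>X | L \<subseteq> X \<and> X \<subseteq> R. (-1) ^ card X) = (\<Sum>Z\<in>Pow (R - L). (-1) ^ card L * (-1) ^ card Z :: real)"
  proof (rule sum.reindex_bij_witness[of _ "\<lambda>Z. L \<union> Z" "\<lambda>X. X - L"])
    fix X assume X: "X \<in> {X. L \<subseteq> X \<and> X \<subseteq> R}"
    hence "finite X" using assms finite_subset by blast
    moreover have "card L \<le> card X" using X \<open>finite X\<close> by (intro card_mono) auto
    ultimately show "(-1) ^ card L * (-1) ^ card (X - L) = ((-1) ^ card X :: real)"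
      using X fin by (simp add: card_Diff_subset flip: power_add)
  qed (use assms in auto)
  also have "\<dots> = (-1) ^ card L * (\<Sum>Z\<in>Pow (R - L). (\<Prod>p\<in>Z. -1) * (\<Prod>p\<in>R - L - Z. 1))"
    by (simp add: sum_distrib_left)
  also have "(\<Sum>Z\<in>Pow (R - L). (\<Prod>p\<in>Z. -1) * (\<Prod>p\<in>R - L - Z. 1)) = (\<Prod>p\<in>R - L. (-1) + (1::real))"
    using assms by (intro prod_add [symmetric]) auto
  also have "\<dots> = (if L = R then 1 else 0)" using assms by (auto simp: power_0_left card_eq_0_iff)
  finally show ?thesis by auto
qed

lemma sieve_density_ge_1: "D \<ge> 1 \<Longrightarrow> sieve_density v D \<ge> 1"
proof -
  assume "D \<ge> 1"
  hence "{} \<in> sieve_moduli v D" by (simp add: sieve_moduli_def)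
  moreover have "0 \<le> (\<Prod>p\<in>X. 1 / (real p - 1))" if "X \<in> sieve_moduli v D" for X
    using sieve_moduliD[OF that] prime_gt_0_nat by (intro prod_nonneg) (force simp: Suc_leI)
  ultimately show ?thesis
    unfolding sieve_density_def using member_le_sum[of "{}" "sieve_moduli v D" "\<lambda>X. \<Prod>p\<in>X. 1 / (real p - 1)"] by simp
qed

text \<open>The worst case is the set of consecutive integers \<open>2, ..., card X + 1\<close>,
  where the product telescopes. The induction therefore removes the maximum, which is at least
  \<open>card X + 1\<close>.\<close>

lemma prod_prime_ratio_le_card:
  assumes "finite X" "\<And>p. p \<in> X \<Longrightarrow> prime p"
  shows "(\<Prod>p\<in>X. real p / (real p - 1)) \<le> real (card X) + 1"
  using assms
proof (induction "card X" arbitrary: X)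
  case 0
  thus ?case by simp
next
  case (Suc n)
  hence ne: "X \<noteq> {}" by auto
  define m where "m = Max X"
  have m: "m \<in> X" using Suc ne by (simp add: m_def)
  have "X \<subseteq> {2..m}" using Suc prime_ge_2_nat by (auto simp: m_def)
  hence "card X \<le> m - 1" using card_mono[of "{2..m}" X] by simp
  hence mn: "m \<ge> Suc n + 1" using Suc by linarith
  have c: "card (X - {m}) = n" using Suc.hyps(2) Suc.prems(1) m by simp
  have IH: "(\<Prod>p\<in>X - {m}. real p / (real p - 1)) \<le> real n + 1"
    using Suc.hyps(1)[OF c [symmetric]] Suc.prems by (simp add: c)
  have "(\<Prod>p\<in>X. real p / (real p - 1)) = real m / (real m - 1) * (\<Prod>p\<in>X - {m}. real p / (real p - 1))"
    using Suc m by (intro prod.remove) auto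
  also have "\<dots> \<le> (real n + 2) / (real n + 1) * (real n + 1)"
  proof (intro mult_mono IH)
    show "real m / (real m - 1) \<le> (real n + 2) / (real n + 1)" using mn by (auto simp: field_simps)
  next
    show "0 \<le> (\<Prod>p\<in>X - {m}. real p / (real p - 1))"
      using Suc prime_gt_0_nat by (intro prod_nonneg) (force simp: Suc_leI)
  qed auto
  also have "\<dots> = real n + 2" by simp
  finally show ?case by (simp flip: Suc.hyps(2))
qed

lemma card_prime_set_le:
  fixes X :: "nat set"
  assumes "finite X" "\<And>p. p \<in> X \<Longrightarrow> prime p"
  shows "2 ^ card X \<le> \<Prod>X"
proof -
  have "(\<Prod>p\<in>X. 2::nat) \<le> \<Prod>X" using assms prime_ge_2_nat by (intro prod_mono) auto
  thus ?thesis by simp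
qed

text \<open>The weights are Selberg's optimal ones; diagonalising the quadratic form uses
  \<open>gcd(d, e) = (\<Sum>l | l dvd gcd(d, e). \<phi>(l))\<close> on squarefree moduli.\<close>

lemma selberg_sieve:
  fixes A :: "'a set" and f :: "'a \<Rightarrow> nat" and T :: real
  assumes fin: "finite A" and D: "D \<ge> 1"
    and equi: "\<And>X. X \<subseteq> {p. prime p \<and> v < p} \<Longrightarrow> finite X \<Longrightarrow>
                 \<bar>real (card {t \<in> A. \<Prod>X dvd f t}) - T / real (\<Prod>X)\<bar> \<le> 1"
  shows "real (card {t \<in> A. \<forall>p. prime p \<and> v < p \<and> p \<le> D \<longrightarrow> \<not> p dvd f t})
           \<le> T / sieve_density v D + (real D * (log 2 (real D) + 1)) ^ 2"
proof -
  define F where "F = sieve_moduli v D"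
  define G where "G = sieve_density v D"
  have finF: "finite F" by (simp add: F_def)
  note FD = sieve_moduliD[where v = v and D = D, folded F_def]
  have Fsub: "Z \<in> F" if "X \<in> F" "Z \<subseteq> X" for X Z using sieve_moduli_subset that by (simp add: F_def)
  have G1: "G \<ge> 1" unfolding G_def using D by (rule sieve_density_ge_1)
  have gt1: "real p > 1" if "X \<in> F" "p \<in> X" for X p using FD[OF that(1)] that(2) prime_gt_1_nat by force
  define ph where "ph X = (\<Prod>p\<in>X. real p - 1)" for X :: "nat set"
  have ph_pos: "ph X > 0" if "X \<in> F" for X unfolding ph_def using gt1[OF that] by (intro prod_pos) auto
  have P_pos: "real (\<Prod>X) > 0" if "X \<in> F" for X
    unfolding of_nat_prod using gt1[OF that] by (intro prod_pos) force
  have G_eq: "G = (\<Sum>X\<in>F. 1 / ph X)" unfolding G_def sieve_density_def F_def ph_def by (simp add: prod_dividef)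
  \<comment> \<open>In the coordinates
    \<open>(\<Sum>X | X \<in> F \<and> L \<subseteq> X. w X)\<close> the quadratic form is diagonal.
    Under the constraint \<open>lam {} = 1\<close> the minimum has them proportional to
    \<open>(-1) ^ card L / ph L\<close>; Moebius inversion then gives this \<open>w\<close>, and
    \<open>dual\<close> verifies it.\<close>
  define w where "w X = (-1) ^ card X * (\<Sum>R | R \<in> F \<and> X \<subseteq> R. 1 / ph R) / G" for X
  define lam where "lam X = real (\<Prod>X) * w X" for X
  have e_in: "{} \<in> F" using D by (simp add: F_def sieve_moduli_def)
  have l1: "lam {} = 1"
  proof -
    have "{R. R \<in> F \<and> {} \<subseteq> R} = F" by auto
    thus ?thesis using G1 by (simp add: lam_def w_def G_eq)
  qed
  have dual: "(\<Sum>X | X \<in> F \<and> L \<subseteq> X. w X) = (-1) ^ card L / (G * ph L)" if L: "L \<in> F" for L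
  proof -
    have "(\<Sum>X | X \<in> F \<and> L \<subseteq> X. w X) = (\<Sum>X | X \<in> F \<and> L \<subseteq> X. \<Sum>R | R \<in> F \<and> X \<subseteq> R. (-1) ^ card X / (G * ph R))"
      unfolding w_def by (simp add: sum_distrib_left sum_divide_distrib mult.commute)
    also have "\<dots> = (\<Sum>X | X \<in> F \<and> L \<subseteq> X. \<Sum>R\<in>F. if X \<subseteq> R then (-1) ^ card X / (G * ph R) else 0)"
      using finF by (simp add: sum.inter_filter)
    also have "\<dots> = (\<Sum>R\<in>F. \<Sum>X | X \<in> F \<and> L \<subseteq> X. if X \<subseteq> R then (-1) ^ card X / (G * ph R) else 0)"
      by (rule sum.swap)
    also have "\<dots> = (\<Sum>R\<in>F. if R = L then (-1) ^ card L / (G * ph L) else 0)"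
    proof (rule sum.cong [OF refl])
      fix R assume R: "R \<in> F"
      have "(\<Sum>X | X \<in> F \<and> L \<subseteq> X. if X \<subseteq> R then (-1) ^ card X / (G * ph R) else 0)
          = (\<Sum>X | X \<in> F \<and> L \<subseteq> X \<and> X \<subseteq> R. (-1) ^ card X / (G * ph R))"
        using finF by (subst sum.inter_filter [symmetric]) (auto intro!: sum.cong)
      also have "{X. X \<in> F \<and> L \<subseteq> X \<and> X \<subseteq> R} = {X. L \<subseteq> X \<and> X \<subseteq> R}" using R Fsub by blast
      also have "(\<Sum>X | L \<subseteq> X \<and> X \<subseteq> R. (-1) ^ card X / (G * ph R)) = (\<Sum>X | L \<subseteq> X \<and> X \<subseteq> R. (-1) ^ card X) / (G * ph R)"
        by (simp add: sum_divide_distrib)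
      also have "\<dots> = (if R = L then (-1) ^ card L / (G * ph L) else 0)"
      proof (cases "L \<subseteq> R")
        case True
        thus ?thesis using sum_alternating_between[of R L] FD(1)[OF R] by auto
      next
        case False
        hence "{X. L \<subseteq> X \<and> X \<subseteq> R} = {}" by blast
        thus ?thesis using False by (simp only: sum.empty) auto
      qed
      finally show "(\<Sum>X | X \<in> F \<and> L \<subseteq> X. if X \<subseteq> R then (-1) ^ card X / (G * ph R) else 0)
          = (if R = L then (-1) ^ card L / (G * ph L) else 0)" .
    qed
    also have "\<dots> = (-1) ^ card L / (G * ph L)" using L finF by simp
    finally show ?thesis .
  qed
  have form: "(\<Sum>X\<in>F. \<Sum>Y\<in>F. lam X * lam Y / real (\<Prod>(X \<union> Y))) = 1 / G"
  proof -
    have "lam X * lam Y / real (\<Prod>(X \<union> Y)) = (\<Sum>L\<in>F. if L \<subseteq> X \<and> L \<subseteq> Y then ph L * (w X * w Y) else 0)"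
      if XY: "X \<in> F" "Y \<in> F" for X Y
    proof -
      note f = FD(1)[OF XY(1)] FD(1)[OF XY(2)]
      have U: "real (\<Prod>(X \<union> Y)) > 0"
        unfolding of_nat_prod using gt1 XY by (intro prod_pos) force
      have "\<Prod>(X \<union> Y) * \<Prod>(X \<inter> Y) = \<Prod>X * \<Prod>Y" using f by (intro prod.union_inter) auto
      hence "real (\<Prod>(X \<union> Y)) * real (\<Prod>(X \<inter> Y)) = real (\<Prod>X) * real (\<Prod>Y)" by (metis of_nat_mult)
      hence "lam X * lam Y / real (\<Prod>(X \<union> Y)) = real (\<Prod>(X \<inter> Y)) * (w X * w Y)"
        unfolding lam_def using U by (simp add: field_simps)
      also have "real (\<Prod>(X \<inter> Y)) = (\<Prod>p\<in>X \<inter> Y. (real p - 1) + 1)" by simp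
      also have "\<dots> = (\<Sum>L\<in>Pow (X \<inter> Y). ph L * (\<Prod>p\<in>X \<inter> Y - L. 1))"
        unfolding ph_def using f by (intro prod_add) auto
      also have "\<dots> = (\<Sum>L | L \<in> F \<and> L \<subseteq> X \<and> L \<subseteq> Y. ph L)"
        using XY Fsub by (intro sum.cong) auto
      finally show ?thesis using finF
        by (subst sum.inter_filter [symmetric]) (simp_all add: sum_distrib_right)
    qed
    hence "(\<Sum>X\<in>F. \<Sum>Y\<in>F. lam X * lam Y / real (\<Prod>(X \<union> Y))) =
        (\<Sum>X\<in>F. \<Sum>Y\<in>F. \<Sum>L\<in>F. if L \<subseteq> X \<and> L \<subseteq> Y then ph L * (w X * w Y) else 0)"
      by (intro sum.cong refl) auto
    also have "\<dots> = (\<Sum>X\<in>F. \<Sum>L\<in>F. \<Sum>Y\<in>F. if L \<subseteq> X \<and> L \<subseteq> Y then ph L * (w X * w Y) else 0)"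
      by (intro sum.cong refl sum.swap)
    also have "\<dots> = (\<Sum>L\<in>F. \<Sum>X\<in>F. \<Sum>Y\<in>F. if L \<subseteq> X \<and> L \<subseteq> Y then ph L * (w X * w Y) else 0)"
      by (rule sum.swap)
    also have "\<dots> = (\<Sum>L\<in>F. ph L * ((\<Sum>X\<in>F. if L \<subseteq> X then w X else 0) * (\<Sum>Y\<in>F. if L \<subseteq> Y then w Y else 0)))"
      by (intro sum.cong refl, simp only: sum_product, simp only: sum_distrib_left)
         (intro sum.cong refl, auto)
    also have "\<dots> = (\<Sum>L\<in>F. ph L * (\<Sum>X | X \<in> F \<and> L \<subseteq> X. w X) ^ 2)"
      using finF by (simp add: sum.inter_filter power2_eq_square)
    also have "\<dots> = (\<Sum>L\<in>F. 1 / ph L / G ^ 2)"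
    proof (intro sum.cong refl)
      fix L assume L: "L \<in> F"
      show "ph L * (\<Sum>X | X \<in> F \<and> L \<subseteq> X. w X) ^ 2 = 1 / ph L / G ^ 2"
        unfolding dual[OF L] using ph_pos[OF L] G1
        by (simp add: power_divide power_mult_distrib power2_eq_square flip: power_mult_distrib)
    qed
    also have "\<dots> = G / G ^ 2" by (simp only: G_eq sum_divide_distrib)
    also have "\<dots> = 1 / G" using G1 by (simp add: power2_eq_square)
    finally show ?thesis .
  qed
  \<comment> \<open>A modulus \<open>R\<close> containing \<open>X\<close> splits into
    \<open>X\<close> and \<open>R - X\<close>, and the latter is again in \<open>F\<close>. The
    resulting bound is weaker than the classical \<open>1\<close>, but a logarithm is harmless since
    \<open>D\<close> will be a power of \<open>T\<close> with exponent below
    \<open>1 / 2\<close>.\<close>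
  have lam_bound: "\<bar>lam X\<bar> \<le> log 2 (real D) + 1" if X: "X \<in> F" for X
  proof -
    have "(\<Sum>R | R \<in> F \<and> X \<subseteq> R. 1 / ph R) \<le> (\<Sum>Z\<in>F. 1 / (ph X * ph Z))"
    proof -
      have "(\<Sum>R | R \<in> F \<and> X \<subseteq> R. 1 / ph R) = (\<Sum>Z\<in>(\<lambda>R. R - X) ` {R. R \<in> F \<and> X \<subseteq> R}. 1 / (ph X * ph Z))"
      proof (subst sum.reindex)
        show "inj_on (\<lambda>R. R - X) {R. R \<in> F \<and> X \<subseteq> R}" by (rule inj_onI) blast
      next
        show "(\<Sum>R | R \<in> F \<and> X \<subseteq> R. 1 / ph R) = sum ((\<lambda>Z. 1 / (ph X * ph Z)) \<circ> (\<lambda>R. R - X)) {R. R \<in> F \<and> X \<subseteq> R}"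
        proof (rule sum.cong [OF refl])
          fix R assume "R \<in> {R. R \<in> F \<and> X \<subseteq> R}"
          hence R: "finite R" "X \<subseteq> R" using FD(1) by blast+
          have "ph R = ph (R - X) * ph X" unfolding ph_def by (rule prod.subset_diff[OF R(2,1)])
          thus "1 / ph R = ((\<lambda>Z. 1 / (ph X * ph Z)) \<circ> (\<lambda>R. R - X)) R"
            by (simp add: mult.commute)
        qed
      qed
      also have "\<dots> \<le> (\<Sum>Z\<in>F. 1 / (ph X * ph Z))"
      proof (rule sum_mono2[OF finF])
        show "(\<lambda>R. R - X) ` {R. R \<in> F \<and> X \<subseteq> R} \<subseteq> F"
        proof (rule image_subsetI)
          fix R assume "R \<in> {R. R \<in> F \<and> X \<subseteq> R}"
          thus "R - X \<in> F" using Fsub[of R "R - X"] by blast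
        qed
        fix Z assume "Z \<in> F - (\<lambda>R. R - X) ` {R. R \<in> F \<and> X \<subseteq> R}"
        hence "ph Z > 0" using ph_pos by blast
        thus "0 \<le> 1 / (ph X * ph Z)" using ph_pos[OF X] by simp
      qed
      finally show ?thesis .
    qed
    also have "\<dots> = G / ph X" unfolding G_eq by (simp add: sum_divide_distrib mult.commute)
    finally have *: "(\<Sum>R | R \<in> F \<and> X \<subseteq> R. 1 / ph R) \<le> G / ph X" .
    have nn: "0 \<le> (\<Sum>R | R \<in> F \<and> X \<subseteq> R. 1 / ph R)" 
      using ph_pos by (intro sum_nonneg divide_nonneg_pos) auto
    have "\<bar>lam X\<bar> = real (\<Prod>X) * ((\<Sum>R | R \<in> F \<and> X \<subseteq> R. 1 / ph R) / G)"
      unfolding lam_def w_def using nn G1 P_pos[OF X] by (simp only: abs_mult abs_divide power_abs) simp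
    also have "\<dots> \<le> real (\<Prod>X) * (G / ph X / G)"
      using * G1 P_pos[OF X] by (intro mult_left_mono divide_right_mono) auto
    also have "\<dots> = (\<Prod>p\<in>X. real p / (real p - 1))" using G1 by (simp add: ph_def prod_dividef)
    also have "\<dots> \<le> real (card X) + 1" using FD[OF X] by (intro prod_prime_ratio_le_card) auto
    also have "real (card X) \<le> log 2 (real D)"
    proof -
      have "2 ^ card X \<le> D" using card_prime_set_le[of X] FD[OF X] by force
      hence "2 ^ card X \<le> real D" by (metis of_nat_le_iff of_nat_numeral of_nat_power)
      thus ?thesis using D by (simp add: le_log_iff powr_realpow)
    qed
    finally show ?thesis by simp
  qed
  have cardF: "card F \<le> D"
  proof -
    have "inj_on (\<lambda>X. \<Prod>X) F"
    proof (rule inj_onI)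
      fix X Y assume "X \<in> F" "Y \<in> F" "\<Prod>X = \<Prod>Y"
      have *: "prime_factors (\<Prod>X) = X" if "X \<in> F" for X
      proof -
        have "prime_factors (\<Prod>X) = \<Union>(prime_factors ` X)"
          using FD[OF that] by (subst prime_factors_prod) (auto dest: prime_gt_0_nat)
        also have "\<dots> = X" using FD(2)[OF that] by (auto simp: prime_prime_factors)
        finally show ?thesis .
      qed
      show "X = Y" using *[OF \<open>X \<in> F\<close>] *[OF \<open>Y \<in> F\<close>] \<open>\<Prod>X = \<Prod>Y\<close> by metis
    qed
    moreover have "(\<lambda>X. \<Prod>X) ` F \<subseteq> {1..D}"
    proof safe
      fix X assume "X \<in> F"
      hence "\<Prod>X > 0" using P_pos by (metis of_nat_0_less_iff)
      thus "\<Prod>X \<in> {1..D}" using FD(4)[OF \<open>X \<in> F\<close>] by (simp add: Suc_le_eq)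
    qed
    ultimately show ?thesis using card_inj_on_le[of "\<lambda>X. \<Prod>X" F "{1..D}"] by simp
  qed
  define S where "S = {t \<in> A. \<forall>p. prime p \<and> v < p \<and> p \<le> D \<longrightarrow> \<not> p dvd f t}"
  \<comment> \<open>Selberg's majorant: \<open>h\<close> equals 1 on \<open>S\<close>, where only
    the empty product divides, and its square is nonnegative on the rest of
    \<open>A\<close>.\<close>
  define h where "h t = (\<Sum>X | X \<in> F \<and> \<Prod>X dvd f t. lam X)" for t
  have "real (card S) = (\<Sum>t\<in>S. (h t)\<^sup>2)"
  proof -
    have "h t = 1" if "t \<in> S" for t
    proof -
      have "{X. X \<in> F \<and> \<Prod>X dvd f t} = {{}}"
      proof (intro equalityI subsetI)
        fix X assume X: "X \<in> {X. X \<in> F \<and> \<Prod>X dvd f t}"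
        have "X = {}"
        proof (rule ccontr)
          assume "X \<noteq> {}"
          then obtain p where p: "p \<in> X" by blast
          hence "p dvd \<Prod>X" using X FD(1) by (intro dvd_prodI) auto
          moreover have "prime p" "v < p" "p \<le> D" using X p by (auto simp: F_def sieve_moduli_def)
          ultimately show False using that X by (auto simp: S_def dest: dvd_trans)
        qed
        thus "X \<in> {{}}" by simp
      qed (use e_in in auto)
      thus ?thesis by (simp add: h_def l1)
    qed
    thus ?thesis by simp
  qed
  also have "\<dots> \<le> (\<Sum>t\<in>A. (h t)\<^sup>2)" using fin by (intro sum_mono2) (auto simp: S_def)
  also have "\<dots> = (\<Sum>t\<in>A. \<Sum>X\<in>F. \<Sum>Y\<in>F. if \<Prod>(X \<union> Y) dvd f t then lam X * lam Y else 0)"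
  proof (rule sum.cong [OF refl])
    fix t
    have iff: "\<Prod>(X \<union> Y) dvd f t \<longleftrightarrow> \<Prod>X dvd f t \<and> \<Prod>Y dvd f t" if XY: "X \<in> F" "Y \<in> F" for X Y
    proof safe
      note f = FD(1)[OF XY(1)] FD(1)[OF XY(2)]
      assume *: "\<Prod>(X \<union> Y) dvd f t"
      have "\<Prod>X dvd \<Prod>(X \<union> Y)" "\<Prod>Y dvd \<Prod>(X \<union> Y)" using f by (auto intro!: prod_dvd_prod_subset)
      thus "\<Prod>X dvd f t" "\<Prod>Y dvd f t" using * dvd_trans by blast+
    next
      note f = FD(1)[OF XY(1)] FD(1)[OF XY(2)]
      assume *: "\<Prod>X dvd f t" "\<Prod>Y dvd f t"
      show "\<Prod>(X \<union> Y) dvd f t"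
      proof (rule prod_primes_dvd)
        fix p assume "p \<in> X \<union> Y"
        thus "prime p" "p dvd f t" using FD(2)[OF XY(1)] FD(2)[OF XY(2)] f * dvd_prodI[of X p id] dvd_prodI[of Y p id]
          by (auto intro: dvd_trans)
      qed (use f in auto)
    qed
    have "h t = (\<Sum>X\<in>F. if \<Prod>X dvd f t then lam X else 0)" unfolding h_def using finF by (simp add: sum.inter_filter)
    hence "(h t)\<^sup>2 = (\<Sum>X\<in>F. \<Sum>Y\<in>F. (if \<Prod>X dvd f t then lam X else 0) * (if \<Prod>Y dvd f t then lam Y else 0))"
      by (simp add: power2_eq_square sum_product)
    also have "\<dots> = (\<Sum>X\<in>F. \<Sum>Y\<in>F. if \<Prod>(X \<union> Y) dvd f t then lam X * lam Y else 0)"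
      by (intro sum.cong refl) (auto simp: iff)
    finally show "(h t)\<^sup>2 = \<dots>" .
  qed
  also have "\<dots> = (\<Sum>X\<in>F. \<Sum>t\<in>A. \<Sum>Y\<in>F. if \<Prod>(X \<union> Y) dvd f t then lam X * lam Y else 0)" by (rule sum.swap)
  also have "\<dots> = (\<Sum>X\<in>F. \<Sum>Y\<in>F. \<Sum>t\<in>A. if \<Prod>(X \<union> Y) dvd f t then lam X * lam Y else 0)"
    by (intro sum.cong refl sum.swap)
  also have "\<dots> = (\<Sum>X\<in>F. \<Sum>Y\<in>F. lam X * lam Y * real (card {t \<in> A. \<Prod>(X \<union> Y) dvd f t}))"
    using fin by (simp add: sum.If_cases Int_def mult.commute)
  also have "\<dots> \<le> (\<Sum>X\<in>F. \<Sum>Y\<in>F. T * (lam X * lam Y / real (\<Prod>(X \<union> Y))) + (log 2 (real D) + 1) ^ 2)"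
  proof (intro sum_mono)
    fix X Y assume XY: "X \<in> F" "Y \<in> F"
    let ?c = "real (card {t \<in> A. \<Prod>(X \<union> Y) dvd f t})"
    have "lam X * lam Y * (?c - T / real (\<Prod>(X \<union> Y))) \<le> \<bar>lam X\<bar> * \<bar>lam Y\<bar> * \<bar>?c - T / real (\<Prod>(X \<union> Y))\<bar>"
      using abs_ge_self[of "lam X * lam Y * (?c - T / real (\<Prod>(X \<union> Y)))"] by (simp only: abs_mult)
    also have "\<dots> \<le> (log 2 (real D) + 1) * (log 2 (real D) + 1) * 1"
    proof (intro mult_mono lam_bound XY equi)
      show "0 \<le> log 2 (real D) + 1" using D by simp
      thus "0 \<le> (log 2 (real D) + 1) * (log 2 (real D) + 1)" by simp
      show "X \<union> Y \<subseteq> {p. prime p \<and> v < p}" using FD[OF XY(1)] FD[OF XY(2)] by auto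
      show "finite (X \<union> Y)" using FD XY by auto
    qed auto
    finally show "lam X * lam Y * ?c \<le> T * (lam X * lam Y / real (\<Prod>(X \<union> Y))) + (log 2 (real D) + 1) ^ 2"
      by (simp add: algebra_simps power2_eq_square)
  qed
  also have "\<dots> = T * (\<Sum>X\<in>F. \<Sum>Y\<in>F. lam X * lam Y / real (\<Prod>(X \<union> Y)))
                    + (\<Sum>X\<in>F. \<Sum>Y\<in>F. (log 2 (real D) + 1) ^ 2)"
    by (simp only: sum.distrib sum_distrib_left)
  also have "\<dots> = T * (1 / G) + (real (card F) * (log 2 (real D) + 1)) ^ 2"
    unfolding form sum_constant by (simp add: power_mult_distrib power2_eq_square mult_ac)
  also have "\<dots> \<le> T * (1 / G) + (real D * (log 2 (real D) + 1)) ^ 2"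
  proof -
    have "0 \<le> log 2 (real D) + 1" using D by simp
    moreover have "real (card F) \<le> real D" using cardF by simp
    ultimately show ?thesis by (intro add_left_mono power_mono mult_right_mono mult_nonneg_nonneg) simp_all
  qed
  finally show ?thesis by (simp add: S_def G_def)
qed

section \<open>Smooth numbers and Erdos--Rankin residues\<close>

text \<open>The product is expanded one prime at a time. The statement is general in
  \<open>m\<close> because \<open>m\<close> collects the prime powers already chosen; when no prime
  is left, at most \<open>N / m\<close> multiples of \<open>m\<close> remain to be counted.\<close>

lemma sum_multiplicative_le:
  fixes h :: "nat \<Rightarrow> nat \<Rightarrow> real"
  assumes "finite P" "\<And>p. p \<in> P \<Longrightarrow> prime p" "\<And>p j. p \<in> P \<Longrightarrow> h p j \<ge> 0"
    and "m > 0" "\<And>p. p \<in> P \<Longrightarrow> coprime p m"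
  shows "(\<Sum>n | n \<in> {1..N} \<and> m dvd n. \<Prod>p\<in>P. \<Sum>j\<le>J. if p ^ j dvd n then h p j else 0)
           \<le> real N / real m * (\<Prod>p\<in>P. \<Sum>j\<le>J. h p j / real p ^ j)"
  using assms
proof (induction P arbitrary: m rule: finite_induct)
  case (empty m)
  have "real (N div m) \<le> real N / real m" by (rule of_nat_div_le_of_nat)
  thus ?case using card_multiples[OF empty.prems(3), of N] by simp
next
  case (insert q P m)
  let ?g = "\<lambda>n. \<Prod>p\<in>P. \<Sum>j\<le>J. if p ^ j dvd n then h p j else 0"
  have "(\<Sum>n | n \<in> {1..N} \<and> m dvd n. \<Prod>p\<in>insert q P. \<Sum>j\<le>J. if p ^ j dvd n then h p j else 0)
      = (\<Sum>n | n \<in> {1..N} \<and> m dvd n. \<Sum>j\<le>J. (if q ^ j dvd n then h q j else 0) * ?g n)"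
    using insert.hyps by (simp add: sum_distrib_right)
  also have "\<dots> = (\<Sum>j\<le>J. \<Sum>n | n \<in> {1..N} \<and> m dvd n. (if q ^ j dvd n then h q j else 0) * ?g n)"
    by (rule sum.swap)
  also have "\<dots> = (\<Sum>j\<le>J. h q j * (\<Sum>n | n \<in> {1..N} \<and> m * q ^ j dvd n. ?g n))"
  proof (rule sum.cong [OF refl])
    fix j
    have cop: "coprime m (q ^ j)" using insert.prems(4)[of q] by (simp add: coprime_commute)
    hence "m * q ^ j dvd n \<longleftrightarrow> m dvd n \<and> q ^ j dvd n" for n
      by (meson divides_mult dvd_mult_left dvd_mult_right)
    hence eq: "{n. n \<in> {1..N} \<and> m * q ^ j dvd n} = {n \<in> {n. n \<in> {1..N} \<and> m dvd n}. q ^ j dvd n}" by auto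
    show "(\<Sum>n | n \<in> {1..N} \<and> m dvd n. (if q ^ j dvd n then h q j else 0) * ?g n)
        = h q j * (\<Sum>n | n \<in> {1..N} \<and> m * q ^ j dvd n. ?g n)"
      unfolding eq sum_distrib_left by (subst sum.inter_filter) (auto intro!: sum.cong)
  qed
  also have "\<dots> \<le> (\<Sum>j\<le>J. h q j * (real N / real (m * q ^ j) * (\<Prod>p\<in>P. \<Sum>j\<le>J. h p j / real p ^ j)))"
  proof (intro sum_mono mult_left_mono insert.IH)
    fix j p assume p: "p \<in> P"
    have "coprime p q" using p insert.hyps insert.prems(1)[of p] insert.prems(1)[of q] by (intro primes_coprime) auto
    thus "coprime p (m * q ^ j)" using insert.prems(4)[of p] p by simp
  qed (use insert.prems in \<open>auto simp: prime_gt_0_nat\<close>)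
  also have "\<dots> = (\<Sum>j\<le>J. (real N / real m * (\<Prod>p\<in>P. \<Sum>j\<le>J. h p j / real p ^ j)) * (h q j / real q ^ j))"
    by (intro sum.cong refl) simp
  also have "\<dots> = real N / real m * (\<Prod>p\<in>insert q P. \<Sum>j\<le>J. h p j / real p ^ j)"
    unfolding sum_distrib_left [symmetric] using insert.hyps by simp
  finally show ?case .
qed

text \<open>Rankin's trick, averaging the multiplicative function \<open>n powr \<eta>\<close> itself instead of
  bounding by a Dirichlet series: this saves a factor \<open>ln Y\<close>.\<close>

lemma card_smooth_le:
  fixes \<eta> B :: real
  assumes Y: "Y \<ge> 1" and \<eta>: "0 \<le> \<eta>" "\<eta> \<le> 1 / 2" and B: "B > 0"
  shows "real (card {n \<in> {1..N}. \<forall>p. prime p \<and> p dvd n \<longrightarrow> p \<le> Y})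
           \<le> B + real N * B powr (-\<eta>) * exp (4 * \<eta> * real Y powr \<eta> * (ln (real Y) + 3))"
proof -
  define P where "P = {p. prime p \<and> p \<le> Y}"
  define s where "s p = real p powr \<eta>" for p
  \<comment> \<open>The Moebius transform of \<open>n powr \<eta>\<close> at prime powers: its
    partial sums over \<open>j\<close> are the powers of \<open>s p\<close>. It is nonnegative
    because \<open>\<eta> \<ge> 0\<close>.\<close>
  define h where "h p j = (if j = 0 then 1 else s p ^ (j - 1) * (s p - 1))" for p j
  let ?S = "{n \<in> {1..N}. \<forall>p. prime p \<and> p dvd n \<longrightarrow> p \<le> Y}"
  have finP: "finite P" by (simp add: P_def)
  have p2: "real p \<ge> 2" "prime p" if "p \<in> P" for p using that prime_ge_2_nat by (force simp: P_def)+
  have s1: "s p \<ge> 1" if "p \<in> P" for p using p2[OF that] \<eta> by (simp add: s_def ge_one_powr_ge_zero)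
  have h_nn: "h p j \<ge> 0" if "p \<in> P" for p j using s1[OF that] by (auto simp: h_def)
  have hsum: "(\<Sum>j\<le>m. h p j) = s p ^ m" for p m
    by (induction m) (auto simp: h_def algebra_simps)
  have eq: "(\<Prod>p\<in>P. \<Sum>j\<le>N. if p ^ j dvd n then h p j else 0) = real n powr \<eta>" if n: "n \<in> ?S" for n
  proof -
    have n0: "n > 0" using n by auto
    have "(\<Sum>j\<le>N. if p ^ j dvd n then h p j else 0) = s p ^ multiplicity p n" if p: "p \<in> P" for p
    proof -
      have "multiplicity p n \<le> N" using multiplicity_less[OF p2(2)[OF p] n0] n by simp
      moreover have "p ^ j dvd n \<longleftrightarrow> j \<le> multiplicity p n" for j
        using p2[OF p] n0 by (intro power_dvd_iff_le_multiplicity) (auto simp: not_prime_unit)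
      ultimately have "{j \<in> {..N}. p ^ j dvd n} = {..multiplicity p n}" by (auto simp: set_eq_iff)
      hence "(\<Sum>j\<le>N. if p ^ j dvd n then h p j else 0) = (\<Sum>j\<le>multiplicity p n. h p j)"
        by (simp flip: sum.inter_filter)
      thus ?thesis by (simp add: hsum)
    qed
    hence "(\<Prod>p\<in>P. \<Sum>j\<le>N. if p ^ j dvd n then h p j else 0) = (\<Prod>p\<in>P. s p ^ multiplicity p n)" by simp
    also have "\<dots> = (\<Prod>p\<in>P. (real p ^ multiplicity p n) powr \<eta>)"
    proof (intro prod.cong refl)
      fix p assume "p \<in> P"
      hence "real p > 0" using p2 by force
      thus "s p ^ multiplicity p n = (real p ^ multiplicity p n) powr \<eta>"
        by (simp add: s_def powr_powr mult.commute flip: powr_realpow)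
    qed
    also have "\<dots> = (\<Prod>p\<in>P. real p ^ multiplicity p n) powr \<eta>"
      by (rule prod_powr_distrib [symmetric])
    also have "(\<Prod>p\<in>P. real p ^ multiplicity p n) = real n"
    proof -
      have "n = (\<Prod>p\<in>P. p ^ multiplicity p n)"
      proof (rule nat_eq_prod_multiplicity[OF n0 finP])
        show "prime_factors n \<subseteq> P" using n n0 by (auto simp: P_def prime_factors_dvd)
      qed (use p2 in blast)
      hence "real n = real (\<Prod>p\<in>P. p ^ multiplicity p n)" by (rule arg_cong)
      thus ?thesis by simp
    qed
    finally show ?thesis .
  qed
  have c: "(\<Sum>j\<le>N. h p j / real p ^ j) \<le> exp (4 * \<eta> * real Y powr \<eta> * (ln (real p) / real p))" if p: "p \<in> P" for p
  proof -
    note p' = p2[OF p] s1[OF p]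
    \<comment> \<open>The restriction \<open>\<eta> \<le> 1 / 2\<close> serves to get
      \<open>real p - s p \<ge> real p / 4\<close> even at \<open>p = 2\<close>; this is the origin
      of the factor \<open>4\<close> in the exponent.\<close>
    have "s p \<le> real p powr (1 / 2)" unfolding s_def using p' \<eta> by (intro powr_mono) auto
    also have "\<dots> = sqrt (real p)" by (simp add: powr_half_sqrt)
    also have "\<dots> \<le> 3 / 4 * real p" using p' by (intro real_le_lsqrt) (auto simp: power2_eq_square)
    finally have sp: "s p \<le> 3 / 4 * real p" .
    have "(\<Sum>j\<le>M. h p j / real p ^ j) \<le> 1 + (s p - 1) / (real p - s p) * (1 - (s p / real p) ^ M)" for M
    proof (induction M)
      case (Suc M)
      have "h p (Suc M) / real p ^ Suc M = (s p - 1) / (real p - s p) * ((s p / real p) ^ M - (s p / real p) ^ Suc M)"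
      proof -
        have "(s p / real p) ^ M - (s p / real p) ^ Suc M = (s p / real p) ^ M * ((real p - s p) / real p)"
          using p' by (simp add: field_simps)
        thus ?thesis using sp p' by (simp add: h_def power_divide mult_ac)
      qed
      moreover have "(s p - 1) / (real p - s p) * (1 - (s p / real p) ^ M) +
            (s p - 1) / (real p - s p) * ((s p / real p) ^ M - (s p / real p) ^ Suc M)
          = (s p - 1) / (real p - s p) * (1 - (s p / real p) ^ Suc M)"
        by (simp only: distrib_left [symmetric]) simp
      ultimately show ?case using Suc unfolding sum.atMost_Suc by linarith
    qed (simp add: h_def)
    hence "(\<Sum>j\<le>N. h p j / real p ^ j) \<le> 1 + (s p - 1) / (real p - s p) * (1 - (s p / real p) ^ N)" .
    also have "\<dots> \<le> 1 + (s p - 1) / (real p - s p) * 1"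
      using sp p' by (intro add_left_mono mult_left_mono divide_nonneg_nonneg) auto
    also have "\<dots> \<le> 1 + (s p - 1) / (real p / 4)"
    proof -
      have "real p / 4 \<le> real p - s p" "0 \<le> s p - 1" "0 < real p" using sp p' by simp_all
      thus ?thesis using divide_left_mono[of "real p / 4" "real p - s p" "s p - 1"] by simp
    qed
    also have "s p - 1 \<le> \<eta> * ln (real p) * real Y powr \<eta>"
    proof -
      have "s p = exp (\<eta> * ln (real p))" using p' by (simp add: s_def powr_def)
      moreover have "1 - \<eta> * ln (real p) \<le> exp (- (\<eta> * ln (real p)))" using exp_ge_add_one_self[of "- (\<eta> * ln (real p))"] by simp
      ultimately have "(1 - \<eta> * ln (real p)) * s p \<le> 1"
        by (simp add: exp_minus field_simps)
      hence "s p - 1 \<le> \<eta> * ln (real p) * s p" by (simp add: algebra_simps)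
      also have "\<dots> \<le> \<eta> * ln (real p) * real Y powr \<eta>"
        using p' \<eta> p unfolding s_def by (intro mult_left_mono powr_mono2) (auto simp: P_def)
      finally show ?thesis .
    qed
    hence "1 + (s p - 1) / (real p / 4) \<le> 1 + (\<eta> * ln (real p) * real Y powr \<eta>) / (real p / 4)"
      using p' by (intro add_left_mono divide_right_mono) auto
    also have "\<dots> = 1 + 4 * \<eta> * real Y powr \<eta> * (ln (real p) / real p)" by simp
    also have "\<dots> \<le> exp (4 * \<eta> * real Y powr \<eta> * (ln (real p) / real p))" by (rule exp_ge_add_one_self)
    finally show ?thesis .
  qed
  have "(\<Sum>n\<in>?S. real n powr \<eta>) = (\<Sum>n\<in>?S. \<Prod>p\<in>P. \<Sum>j\<le>N. if p ^ j dvd n then h p j else 0)"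
    using eq by simp
  also have "\<dots> \<le> (\<Sum>n | n \<in> {1..N} \<and> 1 dvd n. \<Prod>p\<in>P. \<Sum>j\<le>N. if p ^ j dvd n then h p j else 0)"
    using h_nn by (intro sum_mono2 prod_nonneg sum_nonneg) auto
  also have "\<dots> \<le> real N / real 1 * (\<Prod>p\<in>P. \<Sum>j\<le>N. h p j / real p ^ j)"
    using finP p2 h_nn by (intro sum_multiplicative_le) auto
  also have "\<dots> \<le> real N / real 1 * (\<Prod>p\<in>P. exp (4 * \<eta> * real Y powr \<eta> * (ln (real p) / real p)))"
    using c h_nn p2 by (intro mult_left_mono prod_mono conjI sum_nonneg divide_nonneg_nonneg) auto
  also have "\<dots> = real N * exp (4 * \<eta> * real Y powr \<eta> * (\<Sum>p\<in>P. ln (real p) / real p))"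
    using finP by (simp add: exp_sum sum_distrib_left)
  also have "\<dots> \<le> real N * exp (4 * \<eta> * real Y powr \<eta> * (ln (real Y) + 3))"
    using sum_ln_over_prime_bounds[OF Y] \<eta> unfolding P_def
    by (intro mult_left_mono iffD2[OF exp_le_cancel_iff]) (auto intro!: mult_left_mono)
  finally have main: "(\<Sum>n\<in>?S. real n powr \<eta>) \<le> real N * exp (4 * \<eta> * real Y powr \<eta> * (ln (real Y) + 3))" .
  \<comment> \<open>Numbers up to \<open>B\<close> are counted trivially; for the others
    \<open>(n / B) powr \<eta> \<ge> 1\<close>.\<close>
  have "real (card ?S) \<le> real (card {n \<in> ?S. real n \<le> B}) + real (card {n \<in> ?S. real n > B})"
  proof -
    have "?S = {n \<in> ?S. real n \<le> B} \<union> {n \<in> ?S. real n > B}" by auto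
    hence "card ?S = card ({n \<in> ?S. real n \<le> B} \<union> {n \<in> ?S. real n > B})" by (rule arg_cong)
    also have "\<dots> \<le> card {n \<in> ?S. real n \<le> B} + card {n \<in> ?S. real n > B}" by (rule card_Un_le)
    finally show ?thesis by linarith
  qed
  also have "real (card {n \<in> ?S. real n \<le> B}) \<le> B"
  proof -
    have "{n \<in> ?S. real n \<le> B} \<subseteq> {1..nat \<lfloor>B\<rfloor>}" by (auto simp: le_nat_floor)
    hence "card {n \<in> ?S. real n \<le> B} \<le> nat \<lfloor>B\<rfloor>" using card_mono[of "{1..nat \<lfloor>B\<rfloor>}"] by simp
    hence "real (card {n \<in> ?S. real n \<le> B}) \<le> real (nat \<lfloor>B\<rfloor>)" by simp
    also have "\<dots> \<le> B" using B by simp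
    finally show ?thesis .
  qed
  also have "real (card {n \<in> ?S. real n > B}) \<le> (\<Sum>n\<in>?S. real n powr \<eta>) * B powr (-\<eta>)"
  proof -
    have "real (card {n \<in> ?S. real n > B}) * B powr \<eta> = (\<Sum>n\<in>{n \<in> ?S. real n > B}. B powr \<eta>)" by simp
    also have "\<dots> \<le> (\<Sum>n\<in>{n \<in> ?S. real n > B}. real n powr \<eta>)"
      using \<eta> B by (intro sum_mono powr_mono2) auto
    also have "\<dots> \<le> (\<Sum>n\<in>?S. real n powr \<eta>)" by (intro sum_mono2) auto
    finally show ?thesis using B by (simp add: powr_minus field_simps)
  qed
  also have "\<dots> \<le> real N * exp (4 * \<eta> * real Y powr \<eta> * (ln (real Y) + 3)) * B powr (-\<eta>)"
    by (intro mult_right_mono main) auto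
  finally show ?thesis by (simp add: mult.commute mult.left_commute)
qed

text \<open>Averaging over the residues modulo \<open>q\<close>: exactly one of them hits a given
  \<open>k\<close>, which multiplies its weight by \<open>1 / q\<close>, so the mean factor is
  \<open>1 - 1 / q + 1 / q ^ 2\<close> and some residue does no worse. Representatives are taken in
  \<open>(U, U + p]\<close> so that \<open>a p - k\<close> is a genuine difference of
  naturals.\<close>

lemma greedy_residues:
  fixes P S :: "nat set"
  assumes "finite P" "\<And>p. p \<in> P \<Longrightarrow> prime p" "finite S" "\<And>k. k \<in> S \<Longrightarrow> k \<le> U"
  shows "\<exists>a. (\<forall>p\<in>P. U < a p \<and> a p \<le> U + p) \<and>
           (\<Sum>k\<in>S. \<Prod>p\<in>P. if p dvd a p - k then 1 / real p else 1)
             \<le> real (card S) * (\<Prod>p\<in>P. 1 - 1 / real p + 1 / real p ^ 2)"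
  using assms(1,2)
proof (induction P rule: finite_induct)
  case (insert q P)
  then obtain a where a: "\<And>p. p \<in> P \<Longrightarrow> U < a p \<and> a p \<le> U + p"
    "(\<Sum>k\<in>S. \<Prod>p\<in>P. if p dvd a p - k then 1 / real p else 1)
       \<le> real (card S) * (\<Prod>p\<in>P. 1 - 1 / real p + 1 / real p ^ 2)" by auto
  define w where "w k = (\<Prod>p\<in>P. if p dvd a p - k then 1 / real p else 1)" for k
  define c where "c r k = (if q dvd r - k then 1 / real q else 1)" for r k :: nat
  have q: "real q > 1" using insert.prems prime_gt_1_nat by auto
  have w: "w k \<ge> 0" for k unfolding w_def by (intro prod_nonneg) auto
  have "(\<Sum>r\<in>{U<..U+q}. \<Sum>k\<in>S. w k * c r k) = (\<Sum>k\<in>S. w k * (\<Sum>r\<in>{U<..U+q}. c r k))"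
    by (subst sum.swap) (simp add: sum_distrib_left)
  also have "\<dots> \<le> (\<Sum>k\<in>S. w k * (real q - 1 + 1 / real q))"
  proof (intro sum_mono mult_left_mono w)
    fix k assume "k \<in> S"
    hence k: "k \<le> U" using assms(4) by blast
    \<comment> \<open>The element of \<open>(U, U + q]\<close> congruent to \<open>k\<close> modulo
      \<open>q\<close>.\<close>
    define r where "r = U + q - (U - k) mod q"
    have m: "(U - k) mod q < q" "(U - k) mod q \<le> U - k" using q by auto
    have eq: "r - k = (U - k - (U - k) mod q) + q" using k m unfolding r_def by linarith
    have "q dvd U - k - (U - k) mod q" by (rule dvd_minus_mod)
    hence "q dvd r - k" unfolding eq by (rule dvd_add) simp
    moreover have "r \<in> {U<..U+q}" using m by (simp add: r_def)
    ultimately have r: "r \<in> {U<..U+q}" "q dvd r - k" by blast+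
    have "(\<Sum>r\<in>{U<..U+q}. c r k) = c r k + (\<Sum>r\<in>{U<..U+q} - {r}. c r k)"
      using r by (intro sum.remove) auto
    also have "\<dots> \<le> 1 / real q + (\<Sum>r\<in>{U<..U+q} - {r}. 1)"
      using r q by (intro add_mono sum_mono) (auto simp: c_def)
    also have "\<dots> = real q - 1 + 1 / real q" using r q by simp
    finally show "(\<Sum>r\<in>{U<..U+q}. c r k) \<le> real q - 1 + 1 / real q" .
  qed
  also have "\<dots> = sum w S * (real q - 1 + 1 / real q)" by (rule sum_distrib_right [symmetric])
  also have "real q - 1 + 1 / real q = real q * (1 - 1 / real q + 1 / real q ^ 2)"
    using q by (simp add: field_simps power2_eq_square)
  also have "sum w S * (real q * (1 - 1 / real q + 1 / real q ^ 2)) =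
      (\<Sum>r\<in>{U<..U+q}. sum w S * (1 - 1 / real q + 1 / real q ^ 2))" by simp
  finally have le: "(\<Sum>r\<in>{U<..U+q}. \<Sum>k\<in>S. w k * c r k)
      \<le> (\<Sum>r\<in>{U<..U+q}. sum w S * (1 - 1 / real q + 1 / real q ^ 2))" .
  have "\<exists>r\<in>{U<..U+q}. (\<Sum>k\<in>S. w k * c r k) \<le> sum w S * (1 - 1 / real q + 1 / real q ^ 2)"
  proof (rule ccontr)
    assume "\<not> ?thesis"
    hence "(\<Sum>r\<in>{U<..U+q}. sum w S * (1 - 1 / real q + 1 / real q ^ 2))
        < (\<Sum>r\<in>{U<..U+q}. \<Sum>k\<in>S. w k * c r k)"
      using q by (intro sum_strict_mono) (auto simp: not_le)
    thus False using le by simp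
  qed
  then obtain r where r: "r \<in> {U<..U+q}" "(\<Sum>k\<in>S. w k * c r k) \<le> sum w S * (1 - 1 / real q + 1 / real q ^ 2)"
    by blast
  define a' where "a' = a(q := r)"
  have a'P: "a' p = a p" if "p \<in> P" for p using that insert.hyps by (auto simp: a'_def)
  have "(\<Sum>k\<in>S. \<Prod>p\<in>insert q P. if p dvd a' p - k then 1 / real p else 1) = (\<Sum>k\<in>S. w k * c r k)"
    using insert.hyps a'P by (intro sum.cong refl) (simp add: w_def c_def a'_def mult.commute cong: prod.cong)
  also note r(2)
  also have "sum w S * (1 - 1 / real q + 1 / real q ^ 2) \<le>
      (real (card S) * (\<Prod>p\<in>P. 1 - 1 / real p + 1 / real p ^ 2)) * (1 - 1 / real q + 1 / real q ^ 2)"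
  proof (rule mult_right_mono)
    show "sum w S \<le> real (card S) * (\<Prod>p\<in>P. 1 - 1 / real p + 1 / real p ^ 2)"
      using a(2) by (subst sum.cong[OF refl w_def])
    have "1 / real q \<le> 1" "0 \<le> 1 / real q ^ 2" using q by simp_all
    thus "0 \<le> 1 - 1 / real q + 1 / real q ^ 2" by linarith
  qed
  also have "\<dots> = real (card S) * (\<Prod>p\<in>insert q P. 1 - 1 / real p + 1 / real p ^ 2)"
    using insert.hyps by simp
  finally show ?case using a(1) a'P r(1) by (intro exI[of _ a']) (auto simp: a'_def)
qed simp

text \<open>With \<open>b\<close> congruent to \<open>-a p\<close> modulo \<open>p ^ e p\<close>,
  the numbers \<open>b + k\<close> and \<open>a p - k\<close> have the same divisors among the
  divisors of \<open>p ^ e p\<close>. Since \<open>0 < a p - k < p ^ e p\<close>, the full power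
  never divides \<open>b + k\<close>: the gcd with \<open>Q\<close> will see the entire
  \<open>p\<close>-part.\<close>

lemma chinese_remainder_shift:
  fixes P :: "nat set" and a e :: "nat \<Rightarrow> nat"
  assumes "finite P" "\<And>p. p \<in> P \<Longrightarrow> prime p"
    and a: "\<And>p. p \<in> P \<Longrightarrow> U < a p \<and> a p \<le> U + p" and e: "\<And>p. p \<in> P \<Longrightarrow> U + p \<le> p ^ e p"
    and Q: "Q = (\<Prod>p\<in>P. p ^ e p)"
  obtains b where "b < Q" "\<And>p k. p \<in> P \<Longrightarrow> k \<in> {1..U} \<Longrightarrow> p dvd b + k \<longleftrightarrow> p dvd a p - k"
    "\<And>p k. p \<in> P \<Longrightarrow> k \<in> {1..U} \<Longrightarrow> \<not> p ^ e p dvd b + k"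
proof -
  have "\<exists>x. \<forall>p\<in>P. [x = p ^ e p - a p] (mod p ^ e p)"
    using assms(1,2) by (intro chinese_remainder_nat) (auto intro!: primes_coprime)
  then obtain x where x: "\<And>p. p \<in> P \<Longrightarrow> [x = p ^ e p - a p] (mod p ^ e p)" by blast
  define b where "b = x mod Q"
  have Q0: "Q > 0" unfolding Q using assms(2) by (intro prod_pos) (auto simp: prime_gt_0_nat)
  have dvd: "p ^ e p dvd b + a p" if p: "p \<in> P" for p
  proof -
    have "p ^ e p dvd Q" unfolding Q using assms(1) p by (intro dvd_prodI)
    hence "[b = x] (mod p ^ e p)" by (simp add: b_def cong_def mod_mod_cancel)
    hence "[b + a p = p ^ e p - a p + a p] (mod p ^ e p)" using x[OF p] by (intro cong_add) (auto intro: cong_trans)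
    moreover have "p ^ e p - a p + a p = p ^ e p" using a[OF p] e[OF p] by simp
    ultimately show ?thesis by (simp add: cong_0_iff cong_def flip: dvd_eq_mod_eq_0)
  qed
  have key: "d dvd b + k \<longleftrightarrow> d dvd a p - k" if "p \<in> P" "k \<in> {1..U}" "d dvd p ^ e p" for d p k
  proof -
    have "(b + k) + (a p - k) = b + a p" using that a[of p] by auto
    moreover have "d dvd b + a p" using dvd[OF that(1)] that(3) by (rule dvd_trans[rotated])
    ultimately have "d dvd (b + k) + (a p - k)" by simp
    thus ?thesis using dvd_add_right_iff[of d "b + k" "a p - k"] dvd_add_left_iff[of d "a p - k" "b + k"] by blast
  qed
  show thesis
  proof (rule that[of b])
    show "b < Q" using Q0 by (simp add: b_def)
    fix p k assume pk: "p \<in> P" "k \<in> {1..U}"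
    have "e p \<noteq> 0" using e[OF pk(1)] pk prime_gt_1_nat[OF assms(2)[OF pk(1)]] by (intro notI) simp
    hence "p dvd p ^ e p" by (intro dvd_power) auto
    thus "p dvd b + k \<longleftrightarrow> p dvd a p - k" using key pk by blast
    show "\<not> p ^ e p dvd b + k"
    proof
      assume "p ^ e p dvd b + k"
      hence "p ^ e p dvd a p - k" using key[OF pk, of "p ^ e p"] by simp
      moreover have k: "1 \<le> k" "k \<le> U" using pk(2) by auto
      moreover have "0 < a p - k" using a[OF pk(1)] k by linarith
      ultimately have "p ^ e p \<le> a p - k" by (intro dvd_imp_le)
      with k show False using a[OF pk(1)] e[OF pk(1)] by linarith
    qed
  qed
qed

section \<open>Divisors of factorials\<close>

lemma num_divisors_pos: "n > 0 \<Longrightarrow> num_divisors n > 0"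
  unfolding num_divisors_def card_gt_0_iff using finite_divisors_nat[of n] by auto

lemma num_divisors_prime_power_mult:
  assumes p: "prime p" and N: "N > 0" "\<not> p dvd N"
  shows "num_divisors (p ^ v * N) = (v + 1) * num_divisors N"
proof -
  have "bij_betw (\<lambda>(i, d). p ^ i * d) ({..v} \<times> {d. d dvd N}) {k. k dvd p ^ v * N}"
    unfolding bij_betw_def
  proof
    have nd: "\<not> p dvd d" if "d dvd N" for d using N that dvd_trans by blast
    show "inj_on (\<lambda>(i, d). p ^ i * d) ({..v} \<times> {d. d dvd N})"
    proof (rule inj_onI, clarsimp)
      fix i d j d' assume *: "d dvd N" "d' dvd N" "p ^ i * d = p ^ j * d'"
      have "d > 0" "d' > 0" using * N by (auto intro!: Nat.gr0I)
      hence m: "multiplicity p (p ^ l * d) = l" "multiplicity p (p ^ l * d') = l" for l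
        using p nd[OF *(1)] nd[OF *(2)]
        by (auto simp: prime_elem_multiplicity_mult_distrib not_dvd_imp_multiplicity_0)
      hence "i = j" using *(3) by metis
      thus "i = j \<and> d = d'" using * p by (simp add: prime_gt_0_nat)
    qed
    show "(\<lambda>(i, d). p ^ i * d) ` ({..v} \<times> {d. d dvd N}) = {k. k dvd p ^ v * N}"
    proof (intro equalityI subsetI)
      fix k assume "k \<in> {k. k dvd p ^ v * N}"
      then obtain a b where ab: "k = a * b" "a dvd p ^ v" "b dvd N"
        using division_decomp[of k "p ^ v" N] by blast
      then obtain i where "i \<le> v" "a = p ^ i" using p by (auto simp: divides_primepow_nat)
      thus "k \<in> (\<lambda>(i, d). p ^ i * d) ` ({..v} \<times> {d. d dvd N})" using ab by force
    qed (auto intro: mult_dvd_mono le_imp_power_dvd)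
  qed
  hence "card ({..v} \<times> {d. d dvd N}) = card {k. k dvd p ^ v * N}" by (rule bij_betw_same_card)
  thus ?thesis by (simp add: num_divisors_def card_cartesian_product)
qed

lemma num_divisors_mult_prime:
  assumes p: "prime p" and M: "M > 0"
  shows "real (num_divisors (p * M)) = real (num_divisors M) * (1 + 1 / (real (multiplicity p M) + 1))"
proof -
  define v where "v = multiplicity p M"
  obtain N where N: "M = p ^ v * N" "\<not> p dvd N"
    using multiplicity_decompose'[of M p] M p by (metis v_def not_prime_unit neq0_conv mult.commute)
  have N0: "N > 0" using N M by (intro Nat.gr0I) auto
  have "num_divisors M = (v + 1) * num_divisors N" using num_divisors_prime_power_mult[OF p N0 N(2), of v] N by simp
  moreover have "num_divisors (p * M) = (v + 2) * num_divisors N"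
    using num_divisors_prime_power_mult[OF p N0 N(2), of "Suc v"] N by (simp add: mult.assoc)
  ultimately show ?thesis by (simp add: field_simps flip: v_def)
qed

section \<open>Sums of prime factors as the cost of enlarging a factorial\<close>

definition sum_prime_factors :: "nat \<Rightarrow> nat" where
  "sum_prime_factors m = sum_mset (prime_factorization m)"

lemma sum_prime_factors_simps [simp]:
  "sum_prime_factors (Suc 0) = 0"
  "prime p \<Longrightarrow> sum_prime_factors p = p"
  by (auto simp: sum_prime_factors_def prime_factorization_prime)

lemma sum_prime_factors_mult:
  "a > 0 \<Longrightarrow> b > 0 \<Longrightarrow> sum_prime_factors (a * b) = sum_prime_factors a + sum_prime_factors b"
  by (simp add: sum_prime_factors_def prime_factorization_mult)

lemma sum_prime_factors_le: "m > 0 \<Longrightarrow> sum_prime_factors m \<le> m"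
proof (induction m rule: prime_divisors_induct)
  case (factor p m)
  show ?case
  proof (cases "m = 1")
    case False
    have "p \<ge> 2" "m \<ge> 2" using factor False prime_ge_2_nat by auto
    hence "p + m \<le> p * m" by (metis add_leE mult_2 mult_le_mono nat_mult_le_cancel_disj add_mono mult.commute le_add1 add_le_mono le_trans nat_le_linear mult_2_right)
    thus ?thesis using factor by (simp add: sum_prime_factors_mult prime_gt_0_nat)
  qed (use factor in simp)
qed auto

text \<open>A further factor \<open>p\<close> multiplies the number of divisors by
  \<open>1 + 1 / (e + 1)\<close>, where \<open>e\<close> is the current exponent of
  \<open>p\<close>. As the number is a multiple of \<open>fact n\<close>, one has
  \<open>e + 1 \<ge> n / p\<close>, so the factor is at most
  \<open>1 + p / n \<le> exp (p / n)\<close>.\<close>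

lemma num_divisors_mult_le:
  assumes n: "n > 0" "fact n dvd M" "M > 0" and "m > 0"
  shows "real (num_divisors (m * M)) \<le> real (num_divisors M) * exp (real (sum_prime_factors m) / real n)"
  using \<open>m > 0\<close>
proof (induction m rule: prime_divisors_induct)
  case (factor p m)
  hence m: "m > 0" and p: "real p > 0" by (auto simp: prime_gt_0_nat)
  have "real n / real p \<le> real (multiplicity p (m * M)) + 1"
  proof -
    have "n < (n div p + 1) * p" using dividend_less_div_times[of p n] factor prime_gt_0_nat by (simp add: add.commute)
    hence "real n < (real (n div p) + 1) * real p" by (metis of_nat_1 of_nat_add of_nat_less_iff of_nat_mult)
    hence "real n / real p \<le> real (n div p) + 1" using p by (simp add: field_simps)
    also have "n div p \<le> multiplicity p (fact n)"
      using factor n member_le_sum[of 1 "{1..n}" "\<lambda>j. n div p ^ j"] by (simp add: multiplicity_fact)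
    also have "\<dots> \<le> multiplicity p (m * M)"
      using m n by (intro dvd_imp_multiplicity_le) auto
    finally show ?thesis by simp
  qed
  hence *: "1 / (real (multiplicity p (m * M)) + 1) \<le> real p / real n"
    using p n by (simp add: field_simps)
  have "real (num_divisors (p * m * M)) = real (num_divisors (m * M)) * (1 + 1 / (real (multiplicity p (m * M)) + 1))"
    using num_divisors_mult_prime[of p "m * M"] factor m n by (simp add: mult.assoc)
  also have "\<dots> \<le> (real (num_divisors M) * exp (real (sum_prime_factors m) / real n)) * exp (real p / real n)"
  proof (intro mult_mono factor.IH m)
    show "1 + 1 / (real (multiplicity p (m * M)) + 1) \<le> exp (real p / real n)"
      using * exp_ge_add_one_self[of "real p / real n"] by linarith
  qed auto
  also have "\<dots> = real (num_divisors M) * exp (real (sum_prime_factors (p * m)) / real n)"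
    using factor m p by (simp add: sum_prime_factors_mult prime_gt_0_nat add_divide_distrib exp_add)
  finally show ?case .
qed auto

lemma num_divisors_fact_add_le:
  assumes n: "n > 0"
  shows "real (num_divisors (fact (n + K))) \<le>
           real (num_divisors (fact n)) * exp (\<Sum>k\<in>{1..K}. real (sum_prime_factors (n + k)) / real n)"
proof (induction K)
  case (Suc K)
  have "real (num_divisors (fact (n + Suc K))) = real (num_divisors ((n + Suc K) * fact (n + K)))" by simp
  also have "\<dots> \<le> real (num_divisors (fact (n + K))) * exp (real (sum_prime_factors (n + Suc K)) / real n)"
    using n by (intro num_divisors_mult_le fact_dvd) (auto simp del: fact_Suc)
  also have "\<dots> \<le> (real (num_divisors (fact n)) * exp (\<Sum>k\<in>{1..K}. real (sum_prime_factors (n + k)) / real n))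
                  * exp (real (sum_prime_factors (n + Suc K)) / real n)"
    by (intro mult_right_mono Suc.IH) auto
  also have "\<dots> = real (num_divisors (fact n)) * exp (\<Sum>k\<in>{1..Suc K}. real (sum_prime_factors (n + k)) / real n)"
    by (simp add: exp_add)
  finally show ?case .
qed simp

text \<open>The exponent in \<open>num_divisors_fact_add_le\<close> grows with \<open>K\<close>, so
  its value at \<open>U\<close> rules out every \<open>K \<le> U\<close> at once.\<close>

lemma K_fact_greater:
  assumes n: "n > 0" and "(\<Sum>k\<in>{1..U}. real (sum_prime_factors (n + k)) / real n) < ln 2"
  shows "K_fact n > U"
proof (rule ccontr)
  assume "\<not> K_fact n > U"
  hence le: "K_fact n \<le> U" by simp
  let ?s = "\<lambda>K. \<Sum>k\<in>{1..K}. real (sum_prime_factors (n + k)) / real n"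
  have pos: "real (num_divisors (fact n)) > 0" using num_divisors_pos[of "fact n"] by simp
  have "real (num_divisors (fact (n + K_fact n))) / real (num_divisors (fact n)) \<ge> 2"
    using LeastI_ex[OF K_fact_exists[of n]] unfolding K_fact_def by blast
  hence "2 * real (num_divisors (fact n)) \<le> real (num_divisors (fact (n + K_fact n)))"
    using pos by (simp add: le_divide_eq)
  also note num_divisors_fact_add_le[OF n, of "K_fact n"]
  finally have "real (num_divisors (fact n)) * 2 \<le> real (num_divisors (fact n)) * exp (?s (K_fact n))"
    by (simp only: mult.commute)
  hence "2 \<le> exp (?s (K_fact n))" using pos by (simp only: mult_le_cancel_left_pos)
  also have "?s (K_fact n) \<le> ?s U" using le by (intro sum_mono2) auto
  hence "exp (?s (K_fact n)) \<le> exp (?s U)" by simp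
  also have "\<dots> < exp (ln 2)" using assms(2) by (simp only: exp_less_cancel_iff)
  finally show False by simp
qed

section \<open>Long intervals on which the divisor function of the factorial grows slowly\<close>

text \<open>As \<open>q\<close> is invertible modulo \<open>d\<close>, the condition becomes
  \<open>d dvd t + s\<close> for a fixed shift \<open>s\<close>, that is, multiples of
  \<open>d\<close> in a window of length \<open>T\<close>. This supplies the equidistribution
  hypothesis of \<open>selberg_sieve\<close>.\<close>

lemma card_progression_bounds:
  fixes d q c :: nat
  assumes "d > 0" "coprime d q"
  shows "\<bar>real (card {t \<in> {M<..M + T}. d dvd c + q * t}) - real T / real d\<bar> \<le> 1"
proof -
  obtain s where s: "[q * s = c] (mod d)"
    using cong_solve_coprime_nat[of q d] assms(2) by (metis coprime_commute cong_scalar_right mult.assoc mult.left_neutral One_nat_def)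
  have iff: "d dvd c + q * t \<longleftrightarrow> d dvd t + s" for t
  proof -
    have "[c + q * t = q * (t + s)] (mod d)" using s by (simp add: distrib_left cong_sym cong_add add.commute)
    hence "d dvd c + q * t \<longleftrightarrow> d dvd q * (t + s)" by (rule cong_dvd_iff)
    also have "\<dots> \<longleftrightarrow> d dvd t + s" using assms(2) by (rule coprime_dvd_mult_right_iff)
    finally show ?thesis .
  qed
  have "card {t \<in> {M<..M + T}. d dvd c + q * t} = card ((\<lambda>t. t + s) ` {t \<in> {M<..M + T}. d dvd t + s})"
    by (simp add: iff card_image)
  also have "(\<lambda>t. t + s) ` {t \<in> {M<..M + T}. d dvd t + s} = {m \<in> {1..M + T + s}. d dvd m} - {m \<in> {1..M + s}. d dvd m}"
  proof (intro equalityI subsetI)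
    fix m assume m: "m \<in> {m \<in> {1..M + T + s}. d dvd m} - {m \<in> {1..M + s}. d dvd m}"
    hence "M + s < m" "m \<le> M + T + s" "d dvd m" by auto
    thus "m \<in> (\<lambda>t. t + s) ` {t \<in> {M<..M + T}. d dvd t + s}" by (intro image_eqI[of _ _ "m - s"]) auto
  qed auto
  also have "card \<dots> = (M + T + s) div d - (M + s) div d"
  proof -
    have "card ({m \<in> {1..M + T + s}. d dvd m} - {m \<in> {1..M + s}. d dvd m}) =
        card {m \<in> {1..M + T + s}. d dvd m} - card {m \<in> {1..M + s}. d dvd m}"
      by (rule card_Diff_subset) auto
    thus ?thesis by (simp only: card_multiples[OF assms(1)])
  qed
  finally have card: "real (card {t \<in> {M<..M + T}. d dvd c + q * t}) = real ((M + T + s) div d) - real ((M + s) div d)"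
    by (simp add: of_nat_diff div_le_mono)
  have fl: "real (x div d) \<le> real x / real d" "real x / real d - 1 \<le> real (x div d)" for x
  proof -
    show "real (x div d) \<le> real x / real d" by (rule of_nat_div_le_of_nat)
    have "x < (x div d + 1) * d" using dividend_less_div_times[of d x] assms by (simp add: add.commute)
    hence "real x < (real (x div d) + 1) * real d" by (metis of_nat_1 of_nat_add of_nat_less_iff of_nat_mult)
    thus "real x / real d - 1 \<le> real (x div d)" using assms by (simp add: field_simps)
  qed
  have "real (M + T + s) / real d = real (M + s) / real d + real T / real d"
    by (simp add: add_divide_distrib)
  thus ?thesis unfolding card using fl[of "M + T + s"] fl[of "M + s"] by linarith
qed

text \<open>Erdos--Rankin residues: primes in \<open>(Y, v]\<close> divide \<open>b + k\<close> exactly when they divide \<open>k\<close>,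
  the primes up to \<open>Y\<close> are used greedily.\<close>

lemma erdos_rankin_residue:
  fixes e :: "nat \<Rightarrow> nat"
  assumes Y: "Y \<ge> 1" "Y \<le> v"
    and e: "\<And>p. prime p \<Longrightarrow> p \<le> v \<Longrightarrow> U + p \<le> p ^ e p"
    and Q: "Q = (\<Prod>p | prime p \<and> p \<le> v. p ^ e p)"
  obtains b where "b < Q"
    "\<And>p k. prime p \<Longrightarrow> p \<le> v \<Longrightarrow> k \<in> {1..U} \<Longrightarrow> \<not> p ^ e p dvd b + k"
    "(\<Sum>k\<in>{1..U}. 1 / real (gcd (b + k) Q)) \<le> real U / real Y +
       real (card {k \<in> {1..U}. \<forall>p. prime p \<and> Y < p \<and> p \<le> v \<longrightarrow> \<not> p dvd k}) *
       (\<Prod>p | prime p \<and> p \<le> Y. 1 - 1 / real p + 1 / real p ^ 2)"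
proof -
  let ?P = "{p. prime p \<and> p \<le> v}" and ?P1 = "{p. prime p \<and> p \<le> Y}"
  define S where "S = {k \<in> {1..U}. \<forall>p. prime p \<and> Y < p \<and> p \<le> v \<longrightarrow> \<not> p dvd k}"
  have "\<exists>a. (\<forall>p\<in>?P1. U < a p \<and> a p \<le> U + p) \<and>
           (\<Sum>k\<in>S. \<Prod>p\<in>?P1. if p dvd a p - k then 1 / real p else 1)
             \<le> real (card S) * (\<Prod>p\<in>?P1. 1 - 1 / real p + 1 / real p ^ 2)"
    by (rule greedy_residues) (auto simp: S_def)
  then obtain a where a: "\<And>p. p \<in> ?P1 \<Longrightarrow> U < a p \<and> a p \<le> U + p"
    "(\<Sum>k\<in>S. \<Prod>p\<in>?P1. if p dvd a p - k then 1 / real p else 1)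
             \<le> real (card S) * (\<Prod>p\<in>?P1. 1 - 1 / real p + 1 / real p ^ 2)" by blast
  \<comment> \<open>For a middle prime this is the multiple of \<open>p\<close> in
    \<open>(U, U + p]\<close>, so that \<open>p dvd a' p - k\<close> holds iff
    \<open>p dvd k\<close>.\<close>
  define a' where "a' p = (if p \<le> Y then a p else (U div p + 1) * p)" for p
  have a': "U < a' p \<and> a' p \<le> U + p" if p: "p \<in> ?P" for p
  proof (cases "p \<le> Y")
    case True
    thus ?thesis using a(1)[of p] p by (simp add: a'_def)
  next
    case False
    have "p > 0" using p prime_gt_0_nat by blast
    hence "U < (U div p + 1) * p" using dividend_less_div_times[of p U] by (simp add: add.commute)
    moreover have "U div p * p \<le> U" by simp
    ultimately show ?thesis using False by (simp add: a'_def)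
  qed
  obtain b where b: "b < Q" "\<And>p k. p \<in> ?P \<Longrightarrow> k \<in> {1..U} \<Longrightarrow> p dvd b + k \<longleftrightarrow> p dvd a' p - k"
    "\<And>p k. p \<in> ?P \<Longrightarrow> k \<in> {1..U} \<Longrightarrow> \<not> p ^ e p dvd b + k"
    by (rule chinese_remainder_shift[of ?P U a' e Q]) (use a' e Q in auto)
  have Q0: "Q > 0" using b(1) by simp
  have pQ: "p dvd Q" if p: "p \<in> ?P" for p
  proof -
    have "e p \<noteq> 0"
    proof
      assume "e p = 0"
      hence "U + p \<le> 1" using e[of p] p by simp
      thus False using p prime_gt_1_nat[of p] by simp
    qed
    hence "p dvd p ^ e p" by (intro dvd_power) auto
    also have "\<dots> dvd Q" unfolding Q using p by (intro dvd_prodI) auto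
    finally show ?thesis .
  qed
  have g0: "gcd (b + k) Q > 0" for k using Q0 by simp
  have "(\<Sum>k\<in>{1..U}. 1 / real (gcd (b + k) Q)) = (\<Sum>k\<in>S. 1 / real (gcd (b + k) Q)) + (\<Sum>k\<in>{1..U} - S. 1 / real (gcd (b + k) Q))"
    by (subst sum.subset_diff[of S]) (auto simp: S_def)
  also have "(\<Sum>k\<in>S. 1 / real (gcd (b + k) Q)) \<le> (\<Sum>k\<in>S. \<Prod>p\<in>?P1. if p dvd a p - k then 1 / real p else 1)"
  proof (rule sum_mono)
    fix k assume "k \<in> S"
    hence k: "k \<in> {1..U}" by (simp add: S_def)
    let ?X = "{p \<in> ?P1. p dvd a p - k}"
    have "\<Prod>?X dvd gcd (b + k) Q"
    proof (rule prod_primes_dvd)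
      fix p assume p: "p \<in> ?X"
      hence "p \<in> ?P" using Y by auto
      moreover have "p dvd b + k" using b(2)[OF \<open>p \<in> ?P\<close> k] p by (simp add: a'_def)
      ultimately show "p dvd gcd (b + k) Q" using pQ by simp
    qed auto
    hence "\<Prod>?X \<le> gcd (b + k) Q" using g0 by (intro dvd_imp_le)
    hence "real (\<Prod>?X) \<le> real (gcd (b + k) Q)" by (simp only: of_nat_le_iff)
    moreover have "real (\<Prod>?X) > 0" unfolding of_nat_prod by (intro prod_pos) (auto simp: prime_gt_0_nat)
    ultimately have "1 / real (gcd (b + k) Q) \<le> 1 / real (\<Prod>?X)" by (intro frac_le) simp_all
    also have "\<dots> = (\<Prod>p\<in>?X. 1 / real p)" by (simp add: prod_dividef)
    also have "\<dots> = (\<Prod>p\<in>?P1. if p dvd a p - k then 1 / real p else 1)"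
      by (rule prod.inter_filter) simp
    finally show "1 / real (gcd (b + k) Q) \<le> \<dots>" .
  qed
  also note a(2)
  \<comment> \<open>Outside \<open>S\<close> some middle prime divides \<open>k\<close>, hence also
    \<open>b + k\<close>, and the gcd exceeds \<open>Y\<close>.\<close>
  also have "(\<Sum>k\<in>{1..U} - S. 1 / real (gcd (b + k) Q)) \<le> (\<Sum>k\<in>{1..U} - S. 1 / real Y)"
  proof (rule sum_mono)
    fix k assume k: "k \<in> {1..U} - S"
    then obtain p where p: "prime p" "Y < p" "p \<le> v" "p dvd k" by (auto simp: S_def)
    have "p dvd a' p - k" using p by (simp add: a'_def)
    hence "p dvd gcd (b + k) Q" using b(2)[of p k] p k pQ[of p] by simp
    hence "p \<le> gcd (b + k) Q" using g0 by (intro dvd_imp_le)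
    thus "1 / real (gcd (b + k) Q) \<le> 1 / real Y" using p Y by (intro frac_le) simp_all
  qed
  also have "\<dots> \<le> real U / real Y"
  proof -
    have "card ({1..U} - S) \<le> card {1..U}" by (intro card_mono) auto
    hence "real (card ({1..U} - S)) \<le> real U" by simp
    thus ?thesis by (simp add: divide_right_mono)
  qed
  finally show thesis using b by (intro that[of b]) (auto simp: S_def)
qed

text \<open>A composite \<open>h\<close> is \<open>p * m\<close> with both \<open>p\<close> and
  \<open>m\<close> above \<open>v\<close>, and \<open>p + m \<le> 2 * h / v\<close>; only a prime
  \<open>h\<close> has a sum as large as \<open>h\<close>.\<close>

lemma sum_prime_factors_rough_le:
  assumes h: "h > 0" "\<And>p. prime p \<Longrightarrow> p dvd h \<Longrightarrow> v < p" and v: "v > 0"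
  shows "real (sum_prime_factors h) \<le> real h * ((if prime h then 1 else 0) + 2 / real v)"
proof (cases "prime h \<or> h = 1")
  case True
  thus ?thesis using v by (auto simp: algebra_simps)
next
  case False
  then obtain p where p: "prime p" "p dvd h" using prime_factor_nat[of h] by blast
  then obtain m where m: "h = p * m" by blast
  have "m \<noteq> 1" using m False p(1) by (metis mult.right_neutral)
  have "m > 0" using m h(1) by (cases "m = 0") simp_all
  obtain q where q: "prime q" "q dvd m" using prime_factor_nat[OF \<open>m \<noteq> 1\<close>] by blast
  have pv: "v < p" "v < q" using h(2)[OF p] h(2)[OF q(1)] q(2) unfolding m by simp_all
  have "q \<le> m" using q \<open>m > 0\<close> by (intro dvd_imp_le)
  have "sum_prime_factors h = p + sum_prime_factors m"
    using m p \<open>m > 0\<close> by (simp add: sum_prime_factors_mult prime_gt_0_nat)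
  also have "\<dots> \<le> p + m" using sum_prime_factors_le[OF \<open>m > 0\<close>] by simp
  finally have 1: "sum_prime_factors h \<le> p + m" .
  have "p * v \<le> p * m" using pv \<open>q \<le> m\<close> by (intro mult_le_mono2) linarith
  moreover have "m * v \<le> m * p" using pv by (intro mult_le_mono2) linarith
  ultimately have "p * v \<le> h" "m * v \<le> h" by (simp_all add: m mult.commute)
  hence "(p + m) * v \<le> 2 * h" by (simp add: algebra_simps)
  hence "sum_prime_factors h * v \<le> 2 * h" using 1 by (meson le_trans mult_le_mono1)
  hence "real (sum_prime_factors h) * real v \<le> 2 * real h" by (metis of_nat_le_iff of_nat_mult of_nat_numeral)
  thus ?thesis using False v by (simp add: field_simps)
qed

text \<open>\<open>\<beta>\<close> bounds the frequency of prime cofactors and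
  \<open>\<Gamma>\<close> the sum of the reciprocal gcds. The term \<open>2 / v\<close> accounts for
  composite cofactors, the summand \<open>U / T\<close> for the prime factors of the gcds, and the
  factor \<open>1 + U / T\<close> for the quotient of \<open>n + k\<close> by
  \<open>n\<close>.\<close>

lemma exists_K_fact_greater:
  fixes e :: "nat \<Rightarrow> nat"
  assumes Y: "Y \<ge> 1" "Y \<le> v" and D: "1 \<le> D" "D \<le> T"
    and e: "\<And>p. prime p \<Longrightarrow> p \<le> v \<Longrightarrow> U + p \<le> p ^ e p"
    and Q: "Q = (\<Prod>p | prime p \<and> p \<le> v. p ^ e p)"
    and \<beta>: "\<beta> = 1 / sieve_density v D + (real D * (log 2 (real D) + 1)) ^ 2 / real T"
    and \<Gamma>: "\<Gamma> = real U / real Y +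
       real (card {k \<in> {1..U}. \<forall>p. prime p \<and> Y < p \<and> p \<le> v \<longrightarrow> \<not> p dvd k}) *
       (\<Prod>p | prime p \<and> p \<le> Y. 1 - 1 / real p + 1 / real p ^ 2)"
    and less: "real U / real T + (1 + real U / real T) * (\<beta> + 2 / real v) * \<Gamma> < ln 2"
  shows "\<exists>n. T < n \<and> n \<le> 3 * Q * T \<and> K_fact n > U"
proof -
  obtain b where b: "b < Q" "\<And>p k. prime p \<Longrightarrow> p \<le> v \<Longrightarrow> k \<in> {1..U} \<Longrightarrow> \<not> p ^ e p dvd b + k"
    "(\<Sum>k\<in>{1..U}. 1 / real (gcd (b + k) Q)) \<le> \<Gamma>"
    unfolding \<Gamma>
  proof (rule erdos_rankin_residue[OF Y _ Q, of U])
    show "U + p \<le> p ^ e p" if "prime p" "p \<le> v" for p using that by (rule e)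
  qed (rule that, assumption, assumption, simp only: \<Gamma>)
  have T: "T > 0" and v: "v > 0" and Q0: "Q > 0" using D Y b(1) by auto
  define g where "g k = gcd (b + k) Q" for k
  define A where "A = {T<..T + T}"
  define h where "h t k = (b + Q * t + k) div g k" for t k
  have g0: "g k > 0" for k using Q0 by (simp add: g_def)
  have gQ: "g k dvd Q" for k by (simp add: g_def)
  have gh: "b + Q * t + k = g k * h t k" for t k
  proof -
    have "g k dvd (b + k) + Q * t" unfolding g_def by (rule dvd_add[OF gcd_dvd1 dvd_mult2[OF gcd_dvd2]])
    thus ?thesis by (simp add: h_def add_ac)
  qed
  have primeQ: "p \<le> v" if "prime p" "p dvd Q" for p
  proof -
    have "\<exists>r\<in>{p. prime p \<and> p \<le> v}. p dvd r ^ e r"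
      using that prime_dvd_prod_iff[of "{p. prime p \<and> p \<le> v}" p "\<lambda>p. p ^ e p"] unfolding Q by simp
    then obtain r where r: "prime r" "r \<le> v" "p dvd r ^ e r" by blast
    hence "p dvd r" using that(1) prime_dvd_power by blast
    thus ?thesis using r that(1) primes_dvd_imp_eq by blast
  qed
  \<comment> \<open>\<open>e p\<close> exceeds the multiplicity \<open>m\<close> of \<open>p\<close>
    in \<open>g k\<close>. If \<open>p\<close> still divided the cofactor, then
    \<open>p ^ Suc m\<close> would divide both \<open>Q\<close> and \<open>b + k\<close>, hence
    \<open>g k\<close>.\<close>
  have rough: "v < p" if "prime p" "p dvd h t k" "k \<in> {1..U}" for p t k
  proof (rule ccontr)
    assume "\<not> v < p"
    hence pv: "p \<le> v" by simp
    define m where "m = multiplicity p (g k)"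
    have e_dvd: "p ^ e p dvd Q" unfolding Q using that(1) pv by (intro dvd_prodI) auto
    have "m < e p"
    proof (rule ccontr)
      assume "\<not> m < e p"
      hence "p ^ e p dvd g k" unfolding m_def using that(1) g0[of k]
        by (subst power_dvd_iff_le_multiplicity) (auto simp: not_prime_unit)
      thus False using b(2)[OF that(1) pv that(3)] by (simp add: g_def)
    qed
    have "p * p ^ m dvd h t k * g k" unfolding m_def using that(2) by (intro mult_dvd_mono multiplicity_dvd)
    hence d: "p ^ Suc m dvd b + Q * t + k" unfolding gh by (simp add: mult.commute)
    have "p ^ Suc m dvd p ^ e p" using \<open>m < e p\<close> by (intro le_imp_power_dvd) auto
    hence dQ: "p ^ Suc m dvd Q" using e_dvd dvd_trans by blast
    have "b + Q * t + k = (b + k) + Q * t" by simp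
    hence "p ^ Suc m dvd b + k" using d dQ by (metis dvd_add_left_iff dvd_mult2)
    hence "p ^ Suc m dvd g k" using dQ by (simp add: g_def)
    hence "Suc m \<le> m" unfolding m_def using that(1) g0[of k]
      by (subst (asm) power_dvd_iff_le_multiplicity) (auto simp: not_prime_unit)
    thus False by simp
  qed
  have h_ge: "t \<le> h t k" for t k
  proof -
    have "g k * t \<le> Q * t" by (intro mult_le_mono1 dvd_imp_le gQ Q0)
    also have "\<dots> \<le> g k * h t k" using gh[of t k] by linarith
    finally show ?thesis using g0[of k] by simp
  qed
  have count: "real (card {t \<in> A. prime (h t k)}) \<le> real T * \<beta>" if k: "k \<in> {1..U}" for k
  proof -
    have "{t \<in> A. prime (h t k)} \<subseteq> {t \<in> A. \<forall>p. prime p \<and> v < p \<and> p \<le> D \<longrightarrow> \<not> p dvd (b + k) + Q * t}"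
    proof safe
      fix t p assume t: "t \<in> A" "prime (h t k)" and p: "prime p" "v < p" "p \<le> D" "p dvd (b + k) + Q * t"
      have "p dvd g k * h t k" using p(4) gh[of t k] by (simp add: add_ac)
      moreover have "\<not> p dvd g k" using primeQ[OF p(1)] p(2) gQ dvd_trans by (metis not_le)
      ultimately have "p dvd h t k" using p(1) prime_dvd_mult_iff by blast
      hence "p = h t k" using p(1) t(2) primes_dvd_imp_eq by blast
      \<comment> \<open>The cofactor is at least \<open>t > T \<ge> D\<close>, so when it is prime
        it is not one of the sieving primes.\<close>
      thus False using h_ge[of t k] t(1) p(3) D by (simp add: A_def)
    qed
    hence "card {t \<in> A. prime (h t k)} \<le> card {t \<in> A. \<forall>p. prime p \<and> v < p \<and> p \<le> D \<longrightarrow> \<not> p dvd (b + k) + Q * t}"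
      by (intro card_mono) (auto simp: A_def)
    hence "real (card {t \<in> A. prime (h t k)}) \<le> real (card {t \<in> A. \<forall>p. prime p \<and> v < p \<and> p \<le> D \<longrightarrow> \<not> p dvd (b + k) + Q * t})"
      by simp
    also have "\<dots> \<le> real T / sieve_density v D + (real D * (log 2 (real D) + 1)) ^ 2"
    proof (rule selberg_sieve)
      fix X assume X: "X \<subseteq> {p. prime p \<and> v < p}" "finite X"
      have "coprime (\<Prod>X) Q"
      proof (rule prod_coprime_left)
        fix p assume "p \<in> X"
        hence "prime p" "v < p" using X by auto
        thus "coprime p Q" using primeQ[of p] by (intro prime_imp_coprime) auto
      qed
      moreover have "\<Prod>X > 0" using X by (intro prod_pos) (auto simp: prime_gt_0_nat)
      ultimately show "\<bar>real (card {t \<in> A. \<Prod>X dvd (b + k) + Q * t}) - real T / real (\<Prod>X)\<bar> \<le> 1"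
        unfolding A_def by (intro card_progression_bounds)
    qed (use D in \<open>auto simp: A_def\<close>)
    also have "\<dots> = real T * \<beta>" using T by (simp add: \<beta> field_simps)
    finally show ?thesis .
  qed
  define F where "F t = (\<Sum>k\<in>{1..U}. (if prime (h t k) then 1 else 0) / real (g k))" for t
  have \<beta>0: "\<beta> \<ge> 0" using sieve_density_ge_1[OF D(1), of v] by (simp add: \<beta>)
  have "(\<Sum>t\<in>A. F t) = (\<Sum>k\<in>{1..U}. \<Sum>t\<in>A. (if prime (h t k) then 1 else 0) / real (g k))"
    unfolding F_def by (rule sum.swap)
  also have "\<dots> = (\<Sum>k\<in>{1..U}. real (card {t \<in> A. prime (h t k)}) / real (g k))"
    by (simp add: sum_divide_distrib [symmetric] sum.If_cases Int_def A_def)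
  also have "\<dots> \<le> (\<Sum>k\<in>{1..U}. real T * \<beta> * (1 / real (g k)))"
  proof (rule sum_mono)
    fix k assume "k \<in> {1..U}"
    from divide_right_mono[OF count[OF this], of "real (g k)"]
    show "real (card {t \<in> A. prime (h t k)}) / real (g k) \<le> real T * \<beta> * (1 / real (g k))" by simp
  qed
  also have "\<dots> = real T * \<beta> * (\<Sum>k\<in>{1..U}. 1 / real (g k))" by (rule sum_distrib_left [symmetric])
  also have "\<dots> \<le> real T * \<beta> * \<Gamma>" using b(3) \<beta>0 by (intro mult_left_mono) (auto simp: g_def)
  also have "\<dots> = (\<Sum>t\<in>A. \<beta> * \<Gamma>)" by (simp add: A_def)
  finally have "\<exists>t\<in>A. F t \<le> \<beta> * \<Gamma>"
  proof (rule contrapos_pp)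
    assume "\<not> (\<exists>t\<in>A. F t \<le> \<beta> * \<Gamma>)"
    hence "(\<Sum>t\<in>A. \<beta> * \<Gamma>) < (\<Sum>t\<in>A. F t)" using T by (intro sum_strict_mono) (auto simp: A_def not_le)
    thus "\<not> (\<Sum>t\<in>A. F t) \<le> (\<Sum>t\<in>A. \<beta> * \<Gamma>)" by simp
  qed
  then obtain t where t: "t \<in> A" "F t \<le> \<beta> * \<Gamma>" by blast
  define n where "n = b + Q * t"
  have tT: "T < t" "t \<le> 2 * T" using t by (auto simp: A_def)
  have n_gt: "Q * T \<le> n" using tT by (simp add: n_def trans_le_add2)
  have nT: "T < n"
  proof -
    have "T < t" by fact
    also have "t \<le> Q * t" using Q0 by simp
    finally show ?thesis by (simp add: n_def)
  qed
  have "(\<Sum>k\<in>{1..U}. real (sum_prime_factors (n + k)) / real n)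
      \<le> (\<Sum>k\<in>{1..U}. 1 / real T + (1 + real U / real T) * ((if prime (h t k) then 1 else 0) / real (g k) + 2 / real v * (1 / real (g k))))"
  proof (rule sum_mono)
    fix k assume k: "k \<in> {1..U}"
    let ?i = "(if prime (h t k) then 1 else 0) :: real"
    have h0: "h t k > 0" using h_ge[of t k] tT by simp
    have nk: "n + k = g k * h t k" using gh by (simp add: n_def)
    have "sum_prime_factors (n + k) = sum_prime_factors (g k) + sum_prime_factors (h t k)"
      unfolding nk using g0 h0 by (rule sum_prime_factors_mult)
    \<comment> \<open>Crude, but \<open>Q / n \<le> 1 / T\<close>, so all \<open>k\<close> together
      cost at most \<open>U / T\<close>.\<close>
    moreover have "sum_prime_factors (g k) \<le> Q"
      using sum_prime_factors_le[OF g0[of k]] dvd_imp_le[OF gQ[of k] Q0] by linarith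
    moreover have "real (sum_prime_factors (h t k)) \<le> real (h t k) * (?i + 2 / real v)"
      using rough[OF _ _ k] h0 v by (intro sum_prime_factors_rough_le)
    ultimately have "real (sum_prime_factors (n + k)) \<le> real Q + real (h t k) * (?i + 2 / real v)" by linarith
    hence "real (sum_prime_factors (n + k)) / real n \<le> real Q / real n + real (h t k) / real n * (?i + 2 / real v)"
      by (simp add: divide_right_mono add_divide_distrib [symmetric] del: add_divide_distrib)
    also have "real Q / real n \<le> 1 / real T"
    proof -
      have "real Q * real T \<le> real n" using n_gt by (metis of_nat_le_iff of_nat_mult)
      thus ?thesis using T nT by (simp add: field_simps)
    qed
    also have "real (h t k) / real n * (?i + 2 / real v) \<le> ((1 + real U / real T) / real (g k)) * (?i + 2 / real v)"
    proof (rule mult_right_mono)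
      have "real (h t k) = (real n + real k) / real (g k)" using nk g0[of k] by (metis nonzero_mult_div_cancel_left of_nat_0 of_nat_add of_nat_eq_iff of_nat_mult less_irrefl)
      hence "real (h t k) / real n = (1 + real k / real n) / real (g k)" using nT by (simp add: field_simps)
      also have "\<dots> \<le> (1 + real U / real T) / real (g k)"
        using k nT T by (intro divide_right_mono add_left_mono frac_le) auto
      finally show "real (h t k) / real n \<le> (1 + real U / real T) / real (g k)" .
    qed auto
    finally show "real (sum_prime_factors (n + k)) / real n \<le>
        1 / real T + (1 + real U / real T) * (?i / real (g k) + 2 / real v * (1 / real (g k)))"
      by (simp add: algebra_simps add_divide_distrib)
  qed
  also have "\<dots> = real U / real T + (1 + real U / real T) * (F t + 2 / real v * (\<Sum>k\<in>{1..U}. 1 / real (g k)))"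
    by (simp only: sum.distrib sum_distrib_left [symmetric] F_def [symmetric]) simp
  also have "\<dots> \<le> real U / real T + (1 + real U / real T) * (\<beta> * \<Gamma> + 2 / real v * \<Gamma>)"
    using b(3) t(2) by (intro add_left_mono mult_left_mono add_mono) (auto simp: g_def)
  also have "\<dots> = real U / real T + (1 + real U / real T) * (\<beta> + 2 / real v) * \<Gamma>"
    by (simp add: algebra_simps add_divide_distrib)
  also note less
  finally have "K_fact n > U" using nT by (intro K_fact_greater) auto
  moreover have "n \<le> 3 * Q * T"
  proof -
    have "n \<le> Q + Q * (2 * T)" unfolding n_def using b(1) tT by (intro add_mono mult_left_mono) auto
    also have "\<dots> \<le> 3 * Q * T" using T by (cases T) auto
    finally show ?thesis .
  qed
  ultimately show ?thesis using nT by blast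
qed

section \<open>Choice of the parameters\<close>

text \<open>Each factor is \<open>1 - 1 / p\<close> times \<open>1 + 1 / (p * (p - 1))\<close>, and
  the product of the latter is at most \<open>exp 1\<close> by a telescoping sum. This is the source
  of the factor \<open>3\<close> in the final condition on the constant.\<close>

lemma prod_one_minus_primes_le:
  assumes "Y \<ge> 1"
  shows "(\<Prod>p | prime p \<and> p \<le> Y. 1 - 1 / real p + 1 / real p ^ 2)
           \<le> 3 / (\<Prod>p | prime p \<and> p \<le> Y. real p / (real p - 1))"
proof -
  let ?P = "{p. prime p \<and> p \<le> Y}"
  have p2: "real p \<ge> 2" if "p \<in> ?P" for p using that prime_ge_2_nat by force
  have tele: "(\<Sum>n\<in>{2..Y}. 1 / (real n * (real n - 1))) = 1 - 1 / real Y"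
    using assms
  proof (induction Y rule: dec_induct)
    case (step n)
    have "1 / (real (Suc n) * real n) = 1 / real n - 1 / real (Suc n)" using step by (simp add: divide_simps)
    moreover have "{2..Suc n} = insert (Suc n) {2..n}" using step by auto
    ultimately show ?case using step by simp
  qed simp
  have "(\<Prod>p\<in>?P. 1 - 1 / real p + 1 / real p ^ 2)
      = (\<Prod>p\<in>?P. (1 + 1 / (real p * (real p - 1))) / (real p / (real p - 1)))"
  proof (rule prod.cong [OF refl])
    fix p assume "p \<in> ?P"
    from p2[OF this] show "1 - 1 / real p + 1 / real p ^ 2 = (1 + 1 / (real p * (real p - 1))) / (real p / (real p - 1))"
      by (simp add: divide_simps) (simp add: algebra_simps power2_eq_square)
  qed
  also have "\<dots> = (\<Prod>p\<in>?P. 1 + 1 / (real p * (real p - 1))) / (\<Prod>p\<in>?P. real p / (real p - 1))"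
    by (rule prod_dividef)
  also have "\<dots> \<le> 3 / (\<Prod>p\<in>?P. real p / (real p - 1))"
  proof (rule divide_right_mono)
    have "(\<Prod>p\<in>?P. 1 + 1 / (real p * (real p - 1))) \<le> (\<Prod>p\<in>?P. exp (1 / (real p * (real p - 1))))"
    proof (intro prod_mono conjI)
      fix p assume "p \<in> ?P"
      from p2[OF this] have "1 / (real p * (real p - 1)) \<ge> 0" by simp
      thus "0 \<le> 1 + 1 / (real p * (real p - 1))" by linarith
    qed (rule exp_ge_add_one_self)
    also have "\<dots> = exp (\<Sum>p\<in>?P. 1 / (real p * (real p - 1)))" by (simp add: exp_sum)
    also have "\<dots> \<le> exp 1"
    proof -
      have "(\<Sum>p\<in>?P. 1 / (real p * (real p - 1))) \<le> (\<Sum>n\<in>{2..Y}. 1 / (real n * (real n - 1)))"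
        using prime_ge_2_nat by (intro sum_mono2) auto
      also have "\<dots> \<le> 1" unfolding tele by simp
      finally show ?thesis by simp
    qed
    also have "exp 1 \<le> (3::real)" by (rule exp_le)
    finally show "(\<Prod>p\<in>?P. 1 + 1 / (real p * (real p - 1))) \<le> 3" .
    show "0 \<le> (\<Prod>p\<in>?P. real p / (real p - 1))"
    proof (rule prod_nonneg)
      fix p assume "p \<in> ?P"
      from p2[OF this] show "0 \<le> real p / (real p - 1)" by simp
    qed
  qed
  finally show ?thesis .
qed

text \<open>A number counted here is either \<open>Y\<close>-smooth or has a prime factor in
  \<open>(v, U]\<close>. Rankin's bound handles the first kind, multiples of such primes the
  second.\<close>

lemma card_middle_sifted_le:
  fixes \<eta> B :: real
  assumes "Y \<ge> 2" "Y \<le> v" "v \<le> U" and \<eta>: "0 \<le> \<eta>" "\<eta> \<le> 1 / 2" and B: "B > 0"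
  shows "real (card {k \<in> {1..U}. \<forall>p. prime p \<and> Y < p \<and> p \<le> v \<longrightarrow> \<not> p dvd k})
           \<le> real U * (ln (ln (real U) / ln (real v)) + 6 / ln (real v))
             + (B + real U * B powr (-\<eta>) * exp (4 * \<eta> * real Y powr \<eta> * (ln (real Y) + 3)))"
proof -
  let ?S = "{k \<in> {1..U}. \<forall>p. prime p \<and> Y < p \<and> p \<le> v \<longrightarrow> \<not> p dvd k}"
  let ?N = "{n \<in> {1..U}. \<forall>p. prime p \<and> p dvd n \<longrightarrow> p \<le> Y}"
  let ?Q = "{p. prime p \<and> v < p \<and> p \<le> U}"
  let ?M = "\<lambda>q. {m \<in> {1..U}. q dvd m}"
  have "?S \<subseteq> ?N \<union> (\<Union>q\<in>?Q. ?M q)"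
  proof
    fix k assume k: "k \<in> ?S"
    show "k \<in> ?N \<union> (\<Union>q\<in>?Q. ?M q)"
    proof (cases "k \<in> ?N")
      case False
      then obtain p where p: "prime p" "p dvd k" "\<not> p \<le> Y" using k by blast
      hence "\<not> p \<le> v" using k by auto
      moreover have "p \<le> k" using p k by (intro dvd_imp_le) auto
      ultimately have "p \<in> ?Q" "k \<in> ?M p" using p k by auto
      thus ?thesis by blast
    qed simp
  qed
  hence "card ?S \<le> card (?N \<union> (\<Union>q\<in>?Q. ?M q))" by (intro card_mono) auto
  also have "\<dots> \<le> card ?N + card (\<Union>q\<in>?Q. ?M q)" by (rule card_Un_le)
  also have "card (\<Union>q\<in>?Q. ?M q) \<le> (\<Sum>q\<in>?Q. card (?M q))" by (rule card_UN_le) simp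
  finally have "real (card ?S) \<le> real (card ?N) + (\<Sum>q\<in>?Q. real (card (?M q)))"
    by (simp flip: of_nat_sum of_nat_add)
  also have "(\<Sum>q\<in>?Q. real (card (?M q))) \<le> (\<Sum>q\<in>?Q. real U * (1 / real q))"
  proof (rule sum_mono)
    fix q assume "q \<in> ?Q"
    hence "q > 0" by auto
    hence "card (?M q) = U div q" by (rule card_multiples)
    thus "real (card (?M q)) \<le> real U * (1 / real q)" using of_nat_div_le_of_nat[of U q] by simp
  qed
  also have "\<dots> = real U * (\<Sum>q\<in>?Q. 1 / real q)" by (rule sum_distrib_left [symmetric])
  also have "\<dots> \<le> real U * (ln (ln (real U) / ln (real v)) + 6 / ln (real v))"
    using assms by (intro mult_left_mono sum_inverse_primes_le) auto
  also have "real (card ?N) \<le> B + real U * B powr (-\<eta>) * exp (4 * \<eta> * real Y powr \<eta> * (ln (real Y) + 3))"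
    using assms by (intro card_smooth_le) auto
  finally show ?thesis by simp
qed

text \<open>In the term with \<open>R\<close> the density costs the Euler product up to
  \<open>v\<close> and the greedy saving divides by the one up to \<open>Y\<close>. Their quotient
  involves only the primes in \<open>(Y, v]\<close>, so Mertens gives it with a sharp constant;
  bounding the two products separately would lose a constant factor. The other terms are of lower
  order and are bounded crudely.\<close>

lemma sifting_product_bound:
  fixes R :: real
  assumes Y: "Y \<ge> 2" "Y \<le> v" and D: "D \<ge> 2" and err: "err \<ge> 0" and R: "R \<ge> 0"
  shows "(1 / sieve_density v D + err + 2 / real v) *
           (real U / real Y + R * (\<Prod>p | prime p \<and> p \<le> Y. 1 - 1 / real p + 1 / real p ^ 2))
         \<le> (2 * exp (6 / ln 2 + 1) / ln 2) * ln (real v) / ln (real D) * (real U / real Y)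
           + 3 * R * (ln (real v) / ln (real Y) * exp (6 / ln (real Y) + 2 / real Y)) / ln (real D)
           + (err + 2 / real v) * (real U / real Y + 3 * R / ln (real Y))"
proof -
  define V where "V n = (\<Prod>p | prime p \<and> p \<le> n. real p / (real p - 1))" for n :: nat
  define M where "M a b = (\<Prod>p | prime p \<and> a < p \<and> p \<le> b. real p / (real p - 1))" for a b :: nat
  define Pr where "Pr = (\<Prod>p | prime p \<and> p \<le> Y. 1 - 1 / real p + 1 / real p ^ 2)"
  have split: "V b = V a * M a b" if "a \<le> b" for a b
  proof -
    have eq: "{p. prime p \<and> p \<le> b} = {p. prime p \<and> p \<le> a} \<union> {p. prime p \<and> a < p \<and> p \<le> b}"
      using that by auto
    show ?thesis unfolding V_def M_def eq by (rule prod.union_disjoint) auto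
  qed
  have V_ge: "ln (real n + 1) \<le> V n" for n unfolding V_def by (rule ln_le_prod_primes)
  have lnY: "ln (real Y) > 0" and lnD: "ln (real D) > 0" and lnv: "ln (real v) > 0" using Y D by auto
  have VY: "ln (real Y) \<le> V Y" 
  proof -
    have "ln (real Y) \<le> ln (real Y + 1)" using Y by simp
    also have "\<dots> \<le> V Y" by (rule V_ge)
    finally show ?thesis .
  qed
  have V2: "V 2 = 2"
  proof -
    have "p = 2" if "prime p" "p \<le> 2" for p :: nat using that prime_ge_2_nat[of p] by simp
    hence "{p. prime p \<and> p \<le> (2::nat)} = {2}" by auto
    thus ?thesis by (simp add: V_def)
  qed
  \<comment> \<open>The prime 2 is split off because \<open>prod_primes_inverse_le\<close> covers
    only primes above \<open>a \<ge> 2\<close>.\<close>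
  have Vv: "V v \<le> (2 * exp (6 / ln 2 + 1) / ln 2) * ln (real v)"
  proof -
    have "M 2 v \<le> ln (real v) / ln (real 2) * exp (6 / ln (real 2) + 2 / real 2)"
      unfolding M_def using Y by (intro prod_primes_inverse_le) auto
    hence "2 * M 2 v \<le> 2 * (ln (real v) / ln (real 2) * exp (6 / ln (real 2) + 2 / real 2))" by simp
    thus ?thesis using split[of 2 v] V2 Y by (simp add: mult_ac)
  qed
  have MYv: "M Y v \<le> ln (real v) / ln (real Y) * exp (6 / ln (real Y) + 2 / real Y)"
    unfolding M_def using Y by (intro prod_primes_inverse_le) auto
  have Pr: "Pr \<le> 3 / V Y" unfolding Pr_def V_def using Y by (intro prod_one_minus_primes_le) auto
  have VYpos: "V Y > 0" using VY lnY by linarith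
  have M0: "M Y v \<ge> 0" unfolding M_def by (intro prod_nonneg) (auto dest!: prime_gt_0_nat)
  have dens: "1 / sieve_density v D \<le> V v / ln (real D)"
  proof -
    have sd: "sieve_density v D \<ge> 1" using D by (intro sieve_density_ge_1) auto
    have "ln (real D) \<le> ln (real D + 1)" using D by simp
    also have "\<dots> \<le> V v * sieve_density v D" unfolding V_def by (rule ln_le_sieve_density)
    finally show ?thesis using sd lnD by (simp add: field_simps)
  qed
  have RPr: "R * Pr \<le> R * (3 / V Y)" using Pr R by (rule mult_left_mono)
  have nn: "0 \<le> real U / real Y + R * (3 / V Y)" using R VYpos by (intro add_nonneg_nonneg mult_nonneg_nonneg) auto
  have "(1 / sieve_density v D + err + 2 / real v) * (real U / real Y + R * Pr)
      \<le> (1 / sieve_density v D + err + 2 / real v) * (real U / real Y + R * (3 / V Y))"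
    using Pr R err sieve_density_ge_1[of D v] D by (intro mult_left_mono add_left_mono add_nonneg_nonneg) auto
  also have "\<dots> = 1 / sieve_density v D * (real U / real Y + R * (3 / V Y)) + (err + 2 / real v) * (real U / real Y + R * (3 / V Y))"
    by (simp only: distrib_right add.assoc)
  also have "1 / sieve_density v D * (real U / real Y + R * (3 / V Y)) \<le> V v / ln (real D) * (real U / real Y + R * (3 / V Y))"
    using dens nn by (rule mult_right_mono)
  also have "\<dots> = V v / ln (real D) * (real U / real Y) + 3 * R * M Y v / ln (real D)"
    using split[of Y v] Y VYpos lnD by (simp add: field_simps)
  also have "V v / ln (real D) * (real U / real Y) \<le> (2 * exp (6 / ln 2 + 1) / ln 2) * ln (real v) / ln (real D) * (real U / real Y)"
    using Vv lnD by (intro mult_right_mono divide_right_mono) auto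
  also have "3 * R * M Y v / ln (real D) \<le> 3 * R * (ln (real v) / ln (real Y) * exp (6 / ln (real Y) + 2 / real Y)) / ln (real D)"
    using MYv R lnD by (intro mult_left_mono divide_right_mono) auto
  also have "(err + 2 / real v) * (real U / real Y + R * (3 / V Y)) \<le> (err + 2 / real v) * (real U / real Y + 3 * R / ln (real Y))"
  proof (intro mult_left_mono add_left_mono)
    have "R * (3 / V Y) \<le> R * (3 / ln (real Y))" using R VY lnY by (intro mult_left_mono divide_left_mono) auto
    thus "R * (3 / V Y) \<le> 3 * R / ln (real Y)" by (simp add: mult.commute)
  qed (use err in simp)
  finally show ?thesis unfolding Pr_def by simp
qed

text \<open>Chebyshev's bound for \<open>ln p\<close> summed over primes: above
  \<open>sqrt v\<close> every prime contributes at least \<open>ln v / 2\<close>. The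
  \<open>4\<close> is this \<open>2\<close> times the bound \<open>ln 4 \<le> 2\<close>.\<close>

lemma card_primes_le:
  assumes "v \<ge> 2"
  shows "real (card {p. prime p \<and> p \<le> v}) \<le> sqrt (real v) + 4 * real v / ln (real v)"
proof -
  let ?P = "{p. prime p \<and> p \<le> v}"
  have l: "ln (real v) > 0" using assms by simp
  have "?P = {p \<in> ?P. real p \<le> sqrt (real v)} \<union> {p \<in> ?P. real p > sqrt (real v)}" by auto
  hence "card ?P = card ({p \<in> ?P. real p \<le> sqrt (real v)} \<union> {p \<in> ?P. real p > sqrt (real v)})" by (rule arg_cong)
  also have "\<dots> \<le> card {p \<in> ?P. real p \<le> sqrt (real v)} + card {p \<in> ?P. real p > sqrt (real v)}" by (rule card_Un_le)
  finally have "real (card ?P) \<le> real (card {p \<in> ?P. real p \<le> sqrt (real v)}) + real (card {p \<in> ?P. real p > sqrt (real v)})"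
    by linarith
  also have "real (card {p \<in> ?P. real p \<le> sqrt (real v)}) \<le> sqrt (real v)"
  proof -
    have "{p \<in> ?P. real p \<le> sqrt (real v)} \<subseteq> {1..nat \<lfloor>sqrt (real v)\<rfloor>}"
      by (auto simp: le_nat_floor Suc_le_eq prime_gt_0_nat)
    hence "card {p \<in> ?P. real p \<le> sqrt (real v)} \<le> card {1..nat \<lfloor>sqrt (real v)\<rfloor>}"
      by (intro card_mono) auto
    hence "real (card {p \<in> ?P. real p \<le> sqrt (real v)}) \<le> real (nat \<lfloor>sqrt (real v)\<rfloor>)"
      by (simp only: of_nat_le_iff card_atLeastAtMost diff_Suc_1)
    also have "\<dots> \<le> sqrt (real v)" by simp
    finally show ?thesis .
  qed
  also have "real (card {p \<in> ?P. real p > sqrt (real v)}) \<le> 4 * real v / ln (real v)"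
  proof -
    have "real (card {p \<in> ?P. real p > sqrt (real v)}) * (ln (real v) / 2) = (\<Sum>p\<in>{p \<in> ?P. real p > sqrt (real v)}. ln (real v) / 2)" by simp
    also have "\<dots> \<le> (\<Sum>p\<in>{p \<in> ?P. real p > sqrt (real v)}. ln (real p))"
    proof (rule sum_mono)
      fix p assume "p \<in> {p \<in> ?P. real p > sqrt (real v)}"
      hence "sqrt (real v) < real p" by simp
      moreover have "0 < sqrt (real v)" using assms by simp
      ultimately have "ln (sqrt (real v)) \<le> ln (real p)" by (subst ln_le_cancel_iff) linarith+
      thus "ln (real v) / 2 \<le> ln (real p)" using assms by (simp add: ln_sqrt)
    qed
    also have "\<dots> \<le> (\<Sum>p\<in>?P. ln (real p))" by (intro sum_mono2) (auto dest: prime_ge_2_nat)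
    also have "\<dots> \<le> real v * ln 4" by (rule sum_ln_primes_le)
    also have "\<dots> \<le> real v * 2"
    proof -
      have "ln 4 = 2 * ln (2::real)" using ln_realpow[of 2 2] by simp
      also have "ln (2::real) \<le> 1" using ln_le_minus_one[of 2] by simp
      finally show ?thesis by (intro mult_left_mono) auto
    qed
    finally show ?thesis using l by (simp add: field_simps)
  qed
  finally show ?thesis by simp
qed

text \<open>The modulus of the Chinese remainder argument is \<open>exp (o(L))\<close> although it contains a
  power exceeding \<open>U + p\<close> of every prime \<open>p \<le> v\<close>.\<close>

lemma exists_prime_power_modulus:
  assumes "v \<ge> 2"
  obtains e :: "nat \<Rightarrow> nat" where "\<And>p. prime p \<Longrightarrow> p \<le> v \<Longrightarrow> U + p \<le> p ^ e p"
    "ln (real (\<Prod>p | prime p \<and> p \<le> v. p ^ e p))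
       \<le> (sqrt (real v) + 4 * real v / ln (real v)) * ln (real v * (real U + real v))"
proof -
  let ?P = "{p. prime p \<and> p \<le> v}"
  \<comment> \<open>Minimality keeps the power within a factor \<open>p\<close> of the threshold
    \<open>U + p\<close>.\<close>
  define e where "e p = (LEAST i. U + p \<le> p ^ i)" for p
  have ex: "\<exists>i. U + p \<le> p ^ i" if "prime p" for p
    using power_gt_expt[of p "U + p"] prime_gt_1_nat[OF that] by (intro exI[of _ "U + p"]) simp
  have e1: "U + p \<le> p ^ e p" if "prime p" for p
    unfolding e_def using ex[OF that] by (rule LeastI_ex)
  have e2: "p ^ e p \<le> v * (U + v)" if p: "p \<in> ?P" for p
  proof (cases "e p")
    case 0
    thus ?thesis using p assms by (simp add: Suc_le_eq)
  next
    case (Suc i)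
    hence "\<not> U + p \<le> p ^ i" unfolding e_def by (intro not_less_Least) simp
    hence "p * p ^ i \<le> p * (U + p)" by (intro mult_left_mono) auto
    also have "\<dots> \<le> v * (U + v)" using p by (intro mult_mono) auto
    finally show ?thesis using Suc by simp
  qed
  have pos: "real v * (real U + real v) \<ge> 1"
  proof -
    have "real v \<ge> 1" using assms by simp
    hence "1 * 1 \<le> real v * (real U + real v)" by (intro mult_mono) auto
    thus ?thesis by simp
  qed
  have "ln (real (\<Prod>p\<in>?P. p ^ e p)) = ln (\<Prod>p\<in>?P. real (p ^ e p))" by simp
  also have "\<dots> = (\<Sum>p\<in>?P. ln (real (p ^ e p)))"
    by (intro ln_prod) (auto simp: prime_gt_0_nat)
  also have "\<dots> \<le> (\<Sum>p\<in>?P. ln (real v * (real U + real v)))"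
  proof (rule sum_mono)
    fix p assume p: "p \<in> ?P"
    have "real (p ^ e p) \<le> real (v * (U + v))" using e2[OF p] by (simp only: of_nat_le_iff)
    hence "real (p ^ e p) \<le> real v * (real U + real v)" by simp
    moreover have "real (p ^ e p) > 0" using p prime_gt_0_nat by simp
    ultimately show "ln (real (p ^ e p)) \<le> ln (real v * (real U + real v))" by (simp only: ln_mono)
  qed
  also have "\<dots> = real (card ?P) * ln (real v * (real U + real v))" by simp
  also have "\<dots> \<le> (sqrt (real v) + 4 * real v / ln (real v)) * ln (real v * (real U + real v))"
    using card_primes_le[OF assms] pos by (intro mult_right_mono ln_ge_zero) auto
  finally show thesis using e1 by (intro that[of e])
qed

text \<open>The parameters \<open>U\<close>, \<open>v\<close>, \<open>Y\<close> and the exponent \<open>\<eta>\<close> as functions of \<open>L = ln T\<close>; \<open>\<eta>\<close> is such that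
  \<open>L powr (-\<eta>) = (ln L) powr (-11/10)\<close> beats \<open>1 / ln L\<close>, while \<open>Y powr \<eta> = (ln (ln L)) powr (22/25)\<close> is
  \<open>o(ln (ln L))\<close>. The constant \<open>c = 153/2000\<close> only has to satisfy \<open>3 / (4 * pi\<^sup>2) < c\<close> and
  \<open>3 * c * (5/4) / (47/100) < ln 2\<close>.\<close>

definition sieve_length :: "real \<Rightarrow> real" where
  "sieve_length L = 153 / 2000 * L * ln L * ln (ln (ln L)) / (ln (ln L))\<^sup>2"

definition sieve_upper :: "real \<Rightarrow> real" where
  "sieve_upper L = L / ln (ln L)"

definition sieve_lower :: "real \<Rightarrow> real" where
  "sieve_lower L = exp (4 / 5 * ln L * ln (ln (ln L)) / ln (ln L))"

definition rankin_exponent :: "real \<Rightarrow> real" where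
  "rankin_exponent L = 11 / 10 * ln (ln L) / ln L"

lemmas parameter_defs = sieve_length_def sieve_upper_def sieve_lower_def rankin_exponent_def

text \<open>The quotient of \<open>sieve_length L\<close> by \<open>sieve_upper L\<close> is
  \<open>ln L\<close> up to powers of iterated logarithms, so the outer logarithm is about
  \<open>ln (ln L) / ln L\<close>. The left side is asymptotically \<open>765 / 10000\<close> times
  the scale on the right.\<close>

lemma eventually_survivors_middle:
  "eventually (\<lambda>L. sieve_length L * (ln (ln (sieve_length L) / ln (sieve_upper L - 1)) + 6 / ln (sieve_upper L - 1))
     \<le> 767 / 10000 * (L * ln (ln (ln L)) / ln (ln L))) at_top"
  unfolding parameter_defs by real_asymp

text \<open>\<open>L / ln L\<close> is the cutoff \<open>B\<close> in Rankin's bound. The two shares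
  of \<open>1 / 20000\<close>, here and for smooth numbers above \<open>B\<close>, raise
  \<open>767 / 10000\<close> to \<open>768 / 10000\<close>.\<close>

lemma eventually_survivors_small:
  "eventually (\<lambda>L::real. L / ln L \<le> 1 / 20000 * (L * ln (ln (ln L)) / ln (ln L))) at_top"
  by real_asymp

lemma eventually_survivors_smooth:
  "eventually (\<lambda>L. sieve_length L * (L / ln L) powr (- rankin_exponent L) *
       exp (4 * rankin_exponent L * sieve_lower L powr rankin_exponent L * (ln (sieve_lower L) + 3))
     \<le> 1 / 20000 * (L * ln (ln (ln L)) / ln (ln L))) at_top"
  unfolding parameter_defs by real_asymp

text \<open>The limiting constant is \<open>5 / 4\<close>, the inverse of the \<open>4 / 5\<close>
  in \<open>sieve_lower\<close>.\<close>

lemma eventually_mertens_ratio: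
  "eventually (\<lambda>L. ln (sieve_upper L) / ln (sieve_lower L - 1) * exp (6 / ln (sieve_lower L - 1) + 2 / (sieve_lower L - 1))
     \<le> 126 / 100 * (ln (ln L) / ln (ln (ln L)))) at_top"
  unfolding parameter_defs by real_asymp

text \<open>\<open>sieve_lower\<close> outgrows every power of \<open>ln L\<close>, while the
  remaining factors are at most of such size.\<close>

lemma eventually_middle_contribution:
  "eventually (\<lambda>L. (2 * exp (6 / ln 2 + 1) / ln 2) * ln (sieve_upper L) / (47 / 100 * L) *
       (sieve_length L / (sieve_lower L - 1)) \<le> 1 / 1000) at_top"
  unfolding parameter_defs by real_asymp

lemma eventually_composite_contribution:
  "eventually (\<lambda>L. (1 / L ^ 2 + 2 / (sieve_upper L - 1)) * (sieve_length L / (sieve_lower L - 1) +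
       3 * (768 / 10000 * (L * ln (ln (ln L)) / ln (ln L))) / ln (sieve_lower L - 1)) \<le> 1 / 1000) at_top"
  unfolding parameter_defs by real_asymp

text \<open>The level is \<open>D = T powr (48/100)\<close>: with an exponent below
  \<open>1 / 2\<close> the error \<open>D ^ 2\<close> of the sieve saves a power of
  \<open>T\<close>. The \<open>47 / 100\<close> elsewhere absorbs the rounding of
  \<open>D\<close>.\<close>

lemma eventually_selberg_error:
  "eventually (\<lambda>L::real. (exp (48 / 100 * L) * (48 / 100 * L / ln 2 + 1))\<^sup>2 / exp L \<le> 1 / L ^ 2) at_top"
  by real_asymp

lemma eventually_sieve_level: "eventually (\<lambda>L::real. ln (exp (48 / 100 * L) - 1) \<ge> 47 / 100 * L) at_top"
  by real_asymp

lemma eventually_length_small: "eventually (\<lambda>L. sieve_length L / exp L \<le> 1 / 1000) at_top"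
  unfolding parameter_defs by real_asymp

lemma eventually_modulus:
  "eventually (\<lambda>L. (sqrt (sieve_upper L) + 4 * sieve_upper L / ln (sieve_upper L - 1)) *
       ln (sieve_upper L * (sieve_length L + sieve_upper L)) + ln 3 \<le> 1 / 1000 * L) at_top"
  unfolding parameter_defs by real_asymp

text \<open>\<open>ln n\<close> is known only to lie between \<open>L\<close> and
  \<open>1001 / 1000 * L\<close>, so increasing factors are taken at the upper end and the
  denominator at the lower end. There is room because
  \<open>76 * 1001 / 1000 < 153 / 2\<close>.\<close>

lemma eventually_target:
  "eventually (\<lambda>L. 76 / 1000 * (1001 / 1000 * L) *
       (ln (1001 / 1000 * L) * ln (ln (ln (1001 / 1000 * L))) / (ln (ln L))\<^sup>2) < sieve_length L - 1) at_top"
  unfolding parameter_defs by real_asymp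

lemma eventually_parameter_order:
  "eventually (\<lambda>L. 3 \<le> sieve_lower L) at_top"
  "eventually (\<lambda>L. sieve_lower L \<le> sieve_upper L - 1) at_top"
  "eventually (\<lambda>L. sieve_upper L \<le> sieve_length L - 1) at_top"
  "eventually (\<lambda>L. rankin_exponent L \<le> 1 / 2) at_top"
  "eventually (\<lambda>L::real. 2 \<le> exp (48 / 100 * L) - 1) at_top"
  "eventually (\<lambda>L::real. 1 < ln (ln (ln L))) at_top"
  "eventually (\<lambda>L::real. 1 < ln (ln L)) at_top"
  "eventually (\<lambda>L::real. 1 < ln L) at_top"
  "eventually (\<lambda>L::real. 1 < L) at_top"
  unfolding parameter_defs by real_asymp+

section \<open>Assembling the estimates for the chosen parameters\<close>

lemma nat_floor_bounds:
  assumes "x \<ge> (0::real)"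
  shows "real (nat \<lfloor>x\<rfloor>) \<le> x" "x - 1 < real (nat \<lfloor>x\<rfloor>)"
  using assms by linarith+

text \<open>The filter runs over real \<open>L\<close>, as the asymptotic estimates do; the premise
  then singles out the values \<open>L = ln T\<close>.\<close>

lemma eventually_K_fact_large:
  "eventually (\<lambda>L. \<forall>T::nat. L = ln (real T) \<and> T > 0 \<longrightarrow>
     (\<exists>n. T < n \<and> ln (real n) \<le> 1001 / 1000 * L \<and> sieve_length L - 1 < real (K_fact n))) at_top"
  using eventually_survivors_middle eventually_survivors_small eventually_survivors_smooth
    eventually_mertens_ratio eventually_middle_contribution eventually_composite_contribution
    eventually_selberg_error eventually_sieve_level eventually_length_small eventually_modulus
    eventually_parameter_order
proof (eventually_elim, intro allI impI, elim conjE)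
  fix L :: real and T :: nat
  let ?u = "sieve_length L" and ?v = "sieve_upper L" and ?y = "sieve_lower L" and ?\<eta> = "rankin_exponent L"
  \<comment> \<open>The order of magnitude of the number of survivors of the middle primes.\<close>
  define X where "X = L * ln (ln (ln L)) / ln (ln L)"
  assume survivors: "?u * (ln (ln ?u / ln (?v - 1)) + 6 / ln (?v - 1)) \<le> 767 / 10000 * (L * ln (ln (ln L)) / ln (ln L))"
      "L / ln L \<le> 1 / 20000 * (L * ln (ln (ln L)) / ln (ln L))"
      "?u * (L / ln L) powr (- ?\<eta>) * exp (4 * ?\<eta> * ?y powr ?\<eta> * (ln ?y + 3)) \<le> 1 / 20000 * (L * ln (ln (ln L)) / ln (ln L))"
    and mertens: "ln ?v / ln (?y - 1) * exp (6 / ln (?y - 1) + 2 / (?y - 1)) \<le> 126 / 100 * (ln (ln L) / ln (ln (ln L)))"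
    and middle: "(2 * exp (6 / ln 2 + 1) / ln 2) * ln ?v / (47 / 100 * L) * (?u / (?y - 1)) \<le> 1 / 1000"
    and composite: "(1 / L ^ 2 + 2 / (?v - 1)) * (?u / (?y - 1) + 3 * (768 / 10000 * (L * ln (ln (ln L)) / ln (ln L))) / ln (?y - 1)) \<le> 1 / 1000"
    and err: "(exp (48 / 100 * L) * (48 / 100 * L / ln 2 + 1))\<^sup>2 / exp L \<le> 1 / L ^ 2"
    and level: "ln (exp (48 / 100 * L) - 1) \<ge> 47 / 100 * L"
    and small: "?u / exp L \<le> 1 / 1000"
    and modulus: "(sqrt ?v + 4 * ?v / ln (?v - 1)) * ln (?v * (?u + ?v)) + ln 3 \<le> 1 / 1000 * L"
    and order: "3 \<le> ?y" "?y \<le> ?v - 1" "?v \<le> ?u - 1" "?\<eta> \<le> 1 / 2" "2 \<le> exp (48 / 100 * L) - 1"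
      "1 < ln (ln (ln L))" "1 < ln (ln L)" "1 < ln L" "1 < L"
    and L: "L = ln (real T)" and T0: "T > 0"
  have T: "exp L = real T" using L T0 by simp
  \<comment> \<open>Rounding down loses less than 1, which explains the shifts by \<open>1\<close>
    in the asymptotic lemmas.\<close>
  define U v Y D where defs: "U = nat \<lfloor>?u\<rfloor>" "v = nat \<lfloor>?v\<rfloor>" "Y = nat \<lfloor>?y\<rfloor>" "D = nat \<lfloor>exp (48 / 100 * L)\<rfloor>"
  have U: "real U \<le> ?u" "?u - 1 < real U" and v: "real v \<le> ?v" "?v - 1 < real v"
    and Y: "real Y \<le> ?y" "?y - 1 < real Y" and D: "real D \<le> exp (48 / 100 * L)" "exp (48 / 100 * L) - 1 < real D"
    unfolding defs using order by (auto intro!: nat_floor_bounds)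
  have Y2: "real Y > 2" and Yv: "real Y < real v" and vU: "real v < real U" and D2: "real D > 2"
    using U v Y D order by linarith+
  hence nat: "Y \<ge> 2" "Y \<le> v" "v \<ge> 2" "v \<le> U" "D \<ge> 2" by simp_all
  have \<eta>0: "?\<eta> \<ge> 0" using order by (simp add: rankin_exponent_def)
  have X0: "X > 0" using order by (simp add: X_def)
  have lnv: "0 < ln (?v - 1)" "ln (?v - 1) \<le> ln (real v)" "ln (real v) \<le> ln ?v" using order v nat by auto
  have lnY: "0 < ln (?y - 1)" "ln (?y - 1) \<le> ln (real Y)" "ln (real Y) \<le> ln ?y" using order Y nat by auto
  have lnU: "ln (real U) \<le> ln ?u" "ln (real v) \<le> ln (real U)" using U nat by auto
  have lnv0: "0 \<le> ln (real v)" "0 \<le> ln ?v" "0 < ln (real Y)" using lnv lnY by linarith+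
  have lnD: "47 / 100 * L \<le> ln (real D)"
  proof -
    have "ln (exp (48 / 100 * L) - 1) \<le> ln (real D)" using D order by (intro ln_mono; linarith)
    thus ?thesis using level by linarith
  qed
  define S where "S = {k \<in> {1..U}. \<forall>p. prime p \<and> Y < p \<and> p \<le> v \<longrightarrow> \<not> p dvd k}"
  have card_S: "real (card S) \<le> 768 / 10000 * X"
  proof -
    have "real (card S) \<le> real U * (ln (ln (real U) / ln (real v)) + 6 / ln (real v))
             + (L / ln L + real U * (L / ln L) powr (- ?\<eta>) * exp (4 * ?\<eta> * real Y powr ?\<eta> * (ln (real Y) + 3)))"
      unfolding S_def using nat \<eta>0 order by (intro card_middle_sifted_le) auto
    also have "real U * (ln (ln (real U) / ln (real v)) + 6 / ln (real v)) \<le> ?u * (ln (ln ?u / ln (?v - 1)) + 6 / ln (?v - 1))"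
    proof (intro mult_mono add_mono)
      have "1 \<le> ln (real U) / ln (real v)" using lnU lnv by simp
      moreover have "ln (real U) / ln (real v) \<le> ln ?u / ln (?v - 1)" using lnU lnv by (intro frac_le) linarith+
      ultimately show "ln (ln (real U) / ln (real v)) \<le> ln (ln ?u / ln (?v - 1))" by (intro ln_mono; linarith)
      show "6 / ln (real v) \<le> 6 / ln (?v - 1)" using lnv by (intro frac_le) linarith+
      have "0 \<le> ln (ln (real U) / ln (real v))"
        using \<open>1 \<le> ln (real U) / ln (real v)\<close> by (rule ln_ge_zero)
      moreover have "0 \<le> 6 / ln (real v)" using lnv by simp
      ultimately show "0 \<le> ln (ln (real U) / ln (real v)) + 6 / ln (real v)" by linarith
    qed (use U in linarith)+
    also have "real U * (L / ln L) powr (- ?\<eta>) * exp (4 * ?\<eta> * real Y powr ?\<eta> * (ln (real Y) + 3))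
        \<le> ?u * (L / ln L) powr (- ?\<eta>) * exp (4 * ?\<eta> * ?y powr ?\<eta> * (ln ?y + 3))"
    proof (rule mult_mono)
      show "real U * (L / ln L) powr (- ?\<eta>) \<le> ?u * (L / ln L) powr (- ?\<eta>)"
        using U(1) by (rule mult_right_mono) simp
      have "real Y powr ?\<eta> \<le> ?y powr ?\<eta>" using \<eta>0 Y by (intro powr_mono2) auto
      hence "4 * ?\<eta> * real Y powr ?\<eta> * (ln (real Y) + 3) \<le> 4 * ?\<eta> * ?y powr ?\<eta> * (ln ?y + 3)"
        using \<eta>0 lnY by (intro mult_mono[OF mult_left_mono]) auto
      thus "exp (4 * ?\<eta> * real Y powr ?\<eta> * (ln (real Y) + 3)) \<le> exp (4 * ?\<eta> * ?y powr ?\<eta> * (ln ?y + 3))"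
        by simp
      have "0 \<le> ?u" using U by linarith
      thus "0 \<le> ?u * (L / ln L) powr (- ?\<eta>)" by simp
    qed simp
    finally show ?thesis using survivors unfolding X_def by linarith
  qed
  define Pr where "Pr = (\<Prod>p | prime p \<and> p \<le> Y. 1 - 1 / real p + 1 / real p ^ 2)"
  have Pr0: "Pr \<ge> 0"
    unfolding Pr_def
  proof (rule prod_nonneg)
    fix p assume "p \<in> {p. prime p \<and> p \<le> Y}"
    hence "1 / real p \<le> 1" by (auto dest: prime_ge_1_nat)
    moreover have "0 \<le> 1 / real p ^ 2" by simp
    ultimately show "0 \<le> 1 - 1 / real p + 1 / real p ^ 2" by linarith
  qed
  define E where "E = (real D * (log 2 (real D) + 1)) ^ 2 / real T"
  have E: "0 \<le> E" "E \<le> 1 / L ^ 2"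
  proof -
    have "ln (real D) \<le> ln (exp (48 / 100 * L))" using D D2 by (intro ln_mono; linarith)
    hence "ln (real D) \<le> 48 / 100 * L" by (simp only: ln_exp)
    hence "log 2 (real D) \<le> 48 / 100 * L / ln 2"
      unfolding log_def by (rule divide_right_mono) simp
    moreover have "0 \<le> log 2 (real D)" using D2 by simp
    ultimately have "real D * (log 2 (real D) + 1) \<le> exp (48 / 100 * L) * (48 / 100 * L / ln 2 + 1)"
      using D(1) by (intro mult_mono) auto
    hence "(real D * (log 2 (real D) + 1)) ^ 2 \<le> (exp (48 / 100 * L) * (48 / 100 * L / ln 2 + 1))\<^sup>2"
      using \<open>0 \<le> log 2 (real D)\<close> by (intro power_mono) auto
    hence "E \<le> (exp (48 / 100 * L) * (48 / 100 * L / ln 2 + 1))\<^sup>2 / exp L"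
      unfolding E_def T by (rule divide_right_mono) simp
    thus "E \<le> 1 / L ^ 2" using err by linarith
  qed (simp add: E_def)
  have UY: "real U / real Y \<le> ?u / (?y - 1)" using U Y order by (intro frac_le) auto
  have bound: "(1 / sieve_density v D + E + 2 / real v) * (real U / real Y + real (card S) * Pr) \<le> 62 / 100"
  proof -
    have mono: "(1 / sieve_density v D + E + 2 / real v) * (real U / real Y + real (card S) * Pr)
        \<le> (1 / sieve_density v D + E + 2 / real v) * (real U / real Y + 768 / 10000 * X * Pr)"
      using card_S Pr0 E sieve_density_ge_1[of D v] nat
      by (intro mult_left_mono add_left_mono mult_right_mono add_nonneg_nonneg) auto
    have "(1 / sieve_density v D + E + 2 / real v) * (real U / real Y + 768 / 10000 * X * Pr)
        \<le> (2 * exp (6 / ln 2 + 1) / ln 2) * ln (real v) / ln (real D) * (real U / real Y)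
           + 3 * (768 / 10000 * X) * (ln (real v) / ln (real Y) * exp (6 / ln (real Y) + 2 / real Y)) / ln (real D)
           + (E + 2 / real v) * (real U / real Y + 3 * (768 / 10000 * X) / ln (real Y))"
      unfolding Pr_def using nat E X0 by (intro sifting_product_bound) auto
    note total = order_trans[OF mono this]
    have "(2 * exp (6 / ln 2 + 1) / ln 2) * ln (real v) / ln (real D) * (real U / real Y) \<le>
        (2 * exp (6 / ln 2 + 1) / ln 2) * ln ?v / (47 / 100 * L) * (?u / (?y - 1))"
    proof (rule mult_mono[OF _ UY])
      show "(2 * exp (6 / ln 2 + 1) / ln 2) * ln (real v) / ln (real D) \<le>
          (2 * exp (6 / ln 2 + 1) / ln 2) * ln ?v / (47 / 100 * L)"
      proof (rule frac_le)
        show "(2 * exp (6 / ln 2 + 1) / ln 2) * ln (real v) \<le> (2 * exp (6 / ln 2 + 1) / ln 2) * ln ?v"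
          using lnv(3) by (rule mult_left_mono) simp
        show "0 \<le> (2 * exp (6 / ln 2 + 1) / ln 2) * ln ?v" using lnv0 by (intro mult_nonneg_nonneg) auto
      qed (use lnD order in simp_all)
      show "0 \<le> (2 * exp (6 / ln 2 + 1) / ln 2) * ln ?v / (47 / 100 * L)"
        using lnv0 order by (intro divide_nonneg_nonneg mult_nonneg_nonneg) auto
    qed simp
    also note middle
    finally have 1: "(2 * exp (6 / ln 2 + 1) / ln 2) * ln (real v) / ln (real D) * (real U / real Y) \<le> 1 / 1000" .
    have "3 * (768 / 10000 * X) * (ln (real v) / ln (real Y) * exp (6 / ln (real Y) + 2 / real Y)) / ln (real D)
        \<le> 3 * (768 / 10000 * X) * (126 / 100 * (ln (ln L) / ln (ln (ln L)))) / (47 / 100 * L)"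
    proof (rule frac_le)
      have "ln (real v) / ln (real Y) \<le> ln ?v / ln (?y - 1)" using lnv0 lnv lnY by (intro frac_le) linarith+
      moreover have "6 / ln (real Y) + 2 / real Y \<le> 6 / ln (?y - 1) + 2 / (?y - 1)"
        using lnY Y order by (intro add_mono frac_le) linarith+
      ultimately have "ln (real v) / ln (real Y) * exp (6 / ln (real Y) + 2 / real Y) \<le>
          ln ?v / ln (?y - 1) * exp (6 / ln (?y - 1) + 2 / (?y - 1))"
        using lnv0 lnY by (intro mult_mono) (simp_all add: divide_nonneg_nonneg)
      hence "ln (real v) / ln (real Y) * exp (6 / ln (real Y) + 2 / real Y) \<le> 126 / 100 * (ln (ln L) / ln (ln (ln L)))"
        using mertens by linarith
      thus "3 * (768 / 10000 * X) * (ln (real v) / ln (real Y) * exp (6 / ln (real Y) + 2 / real Y))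
          \<le> 3 * (768 / 10000 * X) * (126 / 100 * (ln (ln L) / ln (ln (ln L))))"
        by (rule mult_left_mono) (use X0 in simp)
      show "0 \<le> 3 * (768 / 10000 * X) * (126 / 100 * (ln (ln L) / ln (ln (ln L))))"
        using X0 order by (intro mult_nonneg_nonneg divide_nonneg_nonneg) auto
    qed (use lnD order in simp_all)
    also have "\<dots> = 3 * (768 / 10000) * (126 / 100) / (47 / 100)"
      using order unfolding X_def by (simp add: field_simps)
    finally have 2: "3 * (768 / 10000 * X) * (ln (real v) / ln (real Y) * exp (6 / ln (real Y) + 2 / real Y)) / ln (real D)
        \<le> 3 * (768 / 10000) * (126 / 100) / (47 / 100)" .
    have "(E + 2 / real v) * (real U / real Y + 3 * (768 / 10000 * X) / ln (real Y))
        \<le> (1 / L ^ 2 + 2 / (?v - 1)) * (?u / (?y - 1) + 3 * (768 / 10000 * X) / ln (?y - 1))"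
    proof (rule mult_mono)
      have "2 / real v \<le> 2 / (?v - 1)" using v order by (intro frac_le) linarith+
      thus "E + 2 / real v \<le> 1 / L ^ 2 + 2 / (?v - 1)" using E by linarith
      have "3 * (768 / 10000 * X) / ln (real Y) \<le> 3 * (768 / 10000 * X) / ln (?y - 1)"
        using X0 lnY by (intro frac_le) linarith+
      thus "real U / real Y + 3 * (768 / 10000 * X) / ln (real Y)
          \<le> ?u / (?y - 1) + 3 * (768 / 10000 * X) / ln (?y - 1)" using UY by linarith
      show "0 \<le> 1 / L ^ 2 + 2 / (?v - 1)" using order by (intro add_nonneg_nonneg) auto
      show "0 \<le> real U / real Y + 3 * (768 / 10000 * X) / ln (real Y)"
        using X0 lnY by (intro add_nonneg_nonneg divide_nonneg_nonneg) auto
    qed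
    also have "\<dots> \<le> 1 / 1000" using composite unfolding X_def .
    finally have 3: "(E + 2 / real v) * (real U / real Y + 3 * (768 / 10000 * X) / ln (real Y)) \<le> 1 / 1000" .
    \<comment> \<open>The middle term is about \<open>0.6177\<close>, and the other two are at most
      \<open>1 / 1000\<close> each.\<close>
    show ?thesis by (rule order_trans[OF total order_trans[OF add_mono[OF add_mono[OF 1 2] 3]]]) simp
  qed
  have UT: "real U / real T \<le> 1 / 1000"
  proof -
    have "real U / real T \<le> ?u / real T" using U(1) by (rule divide_right_mono) simp
    thus ?thesis using small unfolding T by linarith
  qed
  obtain e where e: "\<And>p. prime p \<Longrightarrow> p \<le> v \<Longrightarrow> U + p \<le> p ^ e p"
    "ln (real (\<Prod>p | prime p \<and> p \<le> v. p ^ e p)) \<le> (sqrt (real v) + 4 * real v / ln (real v)) * ln (real v * (real U + real v))"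
    using exists_prime_power_modulus[OF nat(3), of U] by blast
  define Q where "Q = (\<Prod>p | prime p \<and> p \<le> v. p ^ e p)"
  have DT: "D \<le> T"
  proof -
    have "exp (48 / 100 * L) \<le> exp L" using order by simp
    hence "real D \<le> exp L" using D(1) by linarith
    thus ?thesis unfolding T by simp
  qed
  have "\<exists>n. T < n \<and> n \<le> 3 * Q * T \<and> K_fact n > U"
  proof (rule exists_K_fact_greater)
    \<comment> \<open>The numerical budget: \<open>Z\<close> is at most \<open>63 / 100\<close>, and
      together with \<open>U / T \<le> 1 / 1000\<close> this stays below
      \<open>2 / 3 \<le> ln 2\<close>.\<close>
    define Z where "Z = (1 + real U / real T) * ((1 / sieve_density v D + E + 2 / real v) * (real U / real Y + real (card S) * Pr))"
    have "Z \<le> (1 + 1 / 1000) * (62 / 100)"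
      unfolding Z_def using UT bound by (intro mult_mono) (use E sieve_density_ge_1[of D v] nat Pr0 in auto)
    also have "\<dots> \<le> 63 / 100" by simp
    finally have "Z \<le> 63 / 100" .
    moreover have "2 / 3 \<le> ln (2::real)" by (rule ln2_ge_two_thirds)
    ultimately have "real U / real T + Z < ln 2" using UT by linarith
    thus "real U / real T + (1 + real U / real T) * ((1 / sieve_density v D + E) + 2 / real v) *
        (real U / real Y + real (card S) * Pr) < ln 2"
      by (simp only: Z_def mult.assoc)
    show "U + p \<le> p ^ e p" if "prime p" "p \<le> v" for p using that by (rule e(1))
  qed (use nat DT in \<open>simp_all add: Q_def E_def S_def Pr_def\<close>)
  then obtain n where n: "T < n" "n \<le> 3 * Q * T" "K_fact n > U" by blast
  have "ln (real n) \<le> 1001 / 1000 * L"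
  proof -
    have Q0: "real Q > 0" using n by (cases "Q = 0") auto
    have "real n \<le> real (3 * Q * T)" using n(2) by (simp only: of_nat_le_iff)
    hence "real n \<le> 3 * real Q * real T" by simp
    moreover have "real n > 0" using n(1) by simp
    ultimately have "ln (real n) \<le> ln (3 * real Q * real T)" by (intro ln_mono)
    also have "\<dots> = ln 3 + ln (real Q) + L" using Q0 T0 L by (simp add: ln_mult)
    also have "ln (real Q) \<le> (sqrt ?v + 4 * ?v / ln (?v - 1)) * ln (?v * (?u + ?v))"
    proof -
      have "(sqrt (real v) + 4 * real v / ln (real v)) * ln (real v * (real U + real v))
          \<le> (sqrt ?v + 4 * ?v / ln (?v - 1)) * ln (?v * (?u + ?v))"
      proof (rule mult_mono)
        have "4 * real v / ln (real v) \<le> 4 * ?v / ln (?v - 1)"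
          using v lnv by (intro frac_le) linarith+
        moreover have "sqrt (real v) \<le> sqrt ?v" using v(1) by simp
        ultimately show "sqrt (real v) + 4 * real v / ln (real v) \<le> sqrt ?v + 4 * ?v / ln (?v - 1)" by linarith
        have "1 * 1 \<le> real v * (real U + real v)" using nat by (intro mult_mono) auto
        moreover have "real v * (real U + real v) \<le> ?v * (?u + ?v)"
          using v(1) U(1) by (intro mult_mono add_mono) auto
        ultimately show "ln (real v * (real U + real v)) \<le> ln (?v * (?u + ?v))"
            "0 \<le> ln (real v * (real U + real v))" by simp_all
        have "0 \<le> ?v" using v(1) by linarith
        thus "0 \<le> sqrt ?v + 4 * ?v / ln (?v - 1)"
          using lnv by (intro add_nonneg_nonneg divide_nonneg_nonneg) auto
      qed
      thus ?thesis using e(2) unfolding Q_def by linarith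
    qed
    finally show ?thesis using modulus by linarith
  qed
  thus "\<exists>n. T < n \<and> ln (real n) \<le> 1001 / 1000 * L \<and> ?u - 1 < real (K_fact n)"
    using n U(2) by (intro exI[of _ n]) auto
qed

lemma iter_log_simps: "iter_log 1 x = ln x" "iter_log 2 x = ln (ln x)"
  "iter_log 3 x = ln (ln (ln x))" "iter_log 4 x = ln (ln (ln (ln x)))"
  by (simp_all add: iter_log_def numeral_eq_Suc)

theorem theorem1p1:
  fixes \<epsilon> :: real
  assumes "\<epsilon> > 0"
  shows "infinite {n :: nat. n > 0 \<and> (\<forall>j\<in>{1..4}. iter_log j (real n) > 0) \<and>
           real (K_fact n) >
             (3 / (4 * pi ^ 2) - \<epsilon>) * ln (real n) *
             ((iter_log 2 (real n) * iter_log 4 (real n)) / (iter_log 3 (real n)) ^ 2)}"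
    (is "infinite ?A")
proof -
  have "eventually (\<lambda>T::nat. \<exists>n\<in>?A. n > T) at_top"
  proof -
    have ln_top: "filterlim (\<lambda>T::nat. ln (real T)) at_top at_top" by real_asymp
    show ?thesis
      using eventually_gt_at_top[of 0]
        ln_top[THEN filterlim_iff[THEN iffD1], rule_format, OF eventually_K_fact_large]
        ln_top[THEN filterlim_iff[THEN iffD1], rule_format, OF eventually_target]
        ln_top[THEN filterlim_iff[THEN iffD1], rule_format, OF eventually_parameter_order(6)]
        ln_top[THEN filterlim_iff[THEN iffD1], rule_format, OF eventually_parameter_order(7)]
        ln_top[THEN filterlim_iff[THEN iffD1], rule_format, OF eventually_parameter_order(8)]
        ln_top[THEN filterlim_iff[THEN iffD1], rule_format, OF eventually_parameter_order(9)]
    proof eventually_elim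
      case (elim T)
      define L where "L = ln (real T)"
      obtain n where n: "T < n" "ln (real n) \<le> 1001 / 1000 * L" "sieve_length L - 1 < real (K_fact n)"
        using elim(1,2) unfolding L_def by blast
      define M where "M = ln (real n)"
      have LM: "L \<le> M" "M \<le> 1001 / 1000 * L" using n elim(1) by (auto simp: L_def M_def)
      have target: "76 / 1000 * (1001 / 1000 * L) *
          (ln (1001 / 1000 * L) * ln (ln (ln (1001 / 1000 * L))) / (ln (ln L))\<^sup>2) < sieve_length L - 1"
        using elim(3) by (simp only: L_def)
      have pos: "1 < ln (ln (ln L))" "1 < ln (ln L)" "1 < ln L" "1 < L" using elim(4-7) by (simp_all only: L_def)
      have M1: "ln L \<le> ln M" using LM(1) pos by (intro ln_mono; linarith)
      have M2: "ln (ln L) \<le> ln (ln M)" using LM M1 pos by (intro ln_mono; linarith)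
      have M3: "ln (ln (ln L)) \<le> ln (ln (ln M))" using LM M1 M2 pos by (intro ln_mono; linarith)
      have N1: "ln M \<le> ln (1001 / 1000 * L)" using LM pos by (intro ln_mono; linarith)
      have N2: "ln (ln M) \<le> ln (ln (1001 / 1000 * L))" using LM M1 N1 pos by (intro ln_mono; linarith)
      have N3: "ln (ln (ln M)) \<le> ln (ln (ln (1001 / 1000 * L)))" using LM M1 M2 pos by (intro ln_mono; linarith)
      let ?R = "ln M * ln (ln (ln M)) / (ln (ln M))\<^sup>2"
      have posM: "0 < ln M" "0 < ln (ln M)" "0 < ln (ln (ln M))" using M1 M2 M3 pos by linarith+
      hence R0: "0 \<le> ?R" by simp
      \<comment> \<open>\<open>3 / (4 * pi ^ 2)\<close> is about \<open>0.07599\<close>.\<close>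
      have c: "3 / (4 * pi ^ 2) - \<epsilon> \<le> 76 / 1000"
      proof -
        have "(3.1415::real)\<^sup>2 \<le> pi ^ 2" using pi_approx(1) by (intro power_mono) auto
        hence "3 / (4 * pi ^ 2) \<le> 76 / 1000" by (simp add: field_simps power2_eq_square)
        thus ?thesis using assms by linarith
      qed
      \<comment> \<open>For large \<open>\<epsilon>\<close> the coefficient is negative; the
        comparison holds all the same, because only \<open>M\<close> and \<open>?R\<close> have to
        be nonnegative.\<close>
      have "(3 / (4 * pi ^ 2) - \<epsilon>) * M * ?R \<le> 76 / 1000 * M * ?R"
        using c LM pos R0 by (intro mult_right_mono) auto
      also have "\<dots> \<le> 76 / 1000 * (1001 / 1000 * L) *
          (ln (1001 / 1000 * L) * ln (ln (ln (1001 / 1000 * L))) / (ln (ln L))\<^sup>2)"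
      proof (rule mult_mono)
        show "76 / 1000 * M \<le> 76 / 1000 * (1001 / 1000 * L)" using LM by simp
        have "ln M * ln (ln (ln M)) \<le> ln (1001 / 1000 * L) * ln (ln (ln (1001 / 1000 * L)))"
          using N1 N3 posM by (intro mult_mono) linarith+
        moreover have "(ln (ln L))\<^sup>2 \<le> (ln (ln M))\<^sup>2" using M2 pos by (intro power_mono) linarith+
        moreover have "0 \<le> ln M * ln (ln (ln M))" "0 < (ln (ln L))\<^sup>2" using posM pos by simp_all
        ultimately show "?R \<le> ln (1001 / 1000 * L) * ln (ln (ln (1001 / 1000 * L))) / (ln (ln L))\<^sup>2"
          by (intro frac_le) linarith+
      qed (use R0 pos in simp_all)
      also note target
      also note n(3)
      finally have "(3 / (4 * pi ^ 2) - \<epsilon>) * M * ?R < real (K_fact n)" .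
      moreover have "\<forall>j\<in>{1..4}. iter_log j (real n) > 0"
      proof
        fix j :: nat assume "j \<in> {1..4}"
        hence "j = 1 \<or> j = 2 \<or> j = 3 \<or> j = 4" by auto
        thus "iter_log j (real n) > 0"
          using pos LM posM by (elim disjE) (simp_all only: iter_log_simps M_def [symmetric])
      qed
      ultimately have "n \<in> ?A" using n(1) by (simp add: iter_log_simps M_def)
      thus ?case using n(1) by blast
    qed
  qed
  hence "\<forall>m. \<exists>n>m. n \<in> ?A"
    unfolding eventually_sequentially by (meson le_cases le_less_trans order_refl)
  thus ?thesis by (simp add: infinite_nat_iff_unbounded)
qed

end
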